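(* For each integer $k>0$ there is $\ell_0\in\mathbb{Z}^+$ such that for all $\ell>\ell_0$ and every monotone arithmetic circuit $C$ of width $k$ with $\mathrm{mon}(C)\subseteq\mathrm{mon}(P^\ell_k)$ and $|\mathrm{mon}(C)|\ge |\mathrm{mon}(P^\ell_k)|/2$, the size of $C$ is at least $2^\ell/10$.
   Context: For positive integers $k,\ell$ define the commutative polynomial $P^\ell_k\in\mathbb{R}[x_1,\dots,x_{\ell^{2k}}]$ by $P^\ell_1(x_1,\dots,x_{\ell^2})=\sum_{i=1}^\ell\prod_{j=1}^\ell x_{(i-1)\ell+j}$ and $P^\ell_{k+1}(x_1,\dots,x_{\ell^{2k+2}})=\sum_{i=1}^\ell\prod_{j=1}^\ell P^\ell_k(x_{(i-1)\ell^{2k+1}+(j-1)\ell^{2k}+1},\dots,x_{(i-1)\ell^{2k+1}+j\ell^{2k}})$. For a polynomial $q$, $\mathrm{mon}(q)$ is its set of monomials with nonzero coefficient; $\mathrm{mon}(C)$ is this set for the polynomial computed by circuit $C$. An arithmetic circuit has leaves labeled by variables or constants and internal $+$/$\times$ gates of indegree two; it is layered if its nodes are partitioned into layers $V_1,\dots,V_t$ with $V_1$ all leaves and children of a node in $V_i$ ($i>1$) lying in $V_1\cup V_{i-1}$; size is the number of nodes and width is $\max_{i>1}|V_i|$. It is monotone if it is over $\mathbb{R}$ and all constants are nonnegative. *)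

theory Defs
  imports Complex_Main "HOL-Library.Poly_Mapping"
begin

text \<open>A monomial is a finitely supported exponent vector; the indeterminates are
  \<open>x\<^sub>i\<close> for \<open>i :: nat\<close>. Multiplication of \<open>poly_mapping\<close> is convolution, which
  with this type of monomials is the multiplication of the commutative polynomial ring.\<close>

type_synonym monomial = "nat \<Rightarrow>\<^sub>0 nat"
type_synonym 'a mpoly = "monomial \<Rightarrow>\<^sub>0 'a"

definition pvar :: "nat \<Rightarrow> 'a::comm_semiring_1 mpoly" where
  "pvar i = Poly_Mapping.single (Poly_Mapping.single i 1) 1"

definition pconst :: "'a::comm_semiring_1 \<Rightarrow> 'a mpoly" where
  "pconst c = Poly_Mapping.single 0 c"

definition mon :: "'a::zero mpoly \<Rightarrow> monomial set" where
  "mon q = Poly_Mapping.keys q"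

text \<open>\<open>Pform l k y\<close> is \<open>P\<^sub>k\<^sup>l(y 1, y 2, \<dots>)\<close>; only the arguments \<open>y 1, \<dots>, y (l ^ (2 * k))\<close>
  are used. The value at \<open>k = 0\<close> is a dummy.\<close>

fun Pform :: "nat \<Rightarrow> nat \<Rightarrow> (nat \<Rightarrow> 'r::comm_semiring_1) \<Rightarrow> 'r" where
  "Pform l 0 y = 0"
| "Pform l (Suc 0) y = (\<Sum>i=1..l. \<Prod>j=1..l. y ((i - 1) * l + j))"
| "Pform l (Suc (Suc k)) y =
     (\<Sum>i=1..l. \<Prod>j=1..l.
        Pform l (Suc k)
          (\<lambda>m. y ((i - 1) * l ^ (2 * Suc k + 1) + (j - 1) * l ^ (2 * Suc k) + m)))"

definition P :: "nat \<Rightarrow> nat \<Rightarrow> real mpoly" where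
  "P l k = Pform l k pvar"

text \<open>The two operands of a gate may be the same node (parallel edges).\<close>

datatype 'a gate = Var nat | Const 'a | Plus nat nat | Times nat nat

text \<open>The label function is only relevant on the node set.\<close>

record 'a circuit =
  nodes :: "nat set"
  label :: "nat \<Rightarrow> 'a gate"
  output_node :: nat

fun operands :: "'a gate \<Rightarrow> nat set" where
  "operands (Var i) = {}"
| "operands (Const c) = {}"
| "operands (Plus u w) = {u, w}"
| "operands (Times u w) = {u, w}"

definition children :: "'a circuit \<Rightarrow> nat \<Rightarrow> nat set" where
  "children C v = operands (label C v)"

definition edges :: "'a circuit \<Rightarrow> (nat \<times> nat) set" where
  "edges C = {(u, v). v \<in> nodes C \<and> u \<in> children C v}"

definition arithmetic_circuit :: "'a circuit \<Rightarrow> bool" where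
  "arithmetic_circuit C \<longleftrightarrow>
     finite (nodes C) \<and> output_node C \<in> nodes C \<and>
     (\<forall>v\<in>nodes C. children C v \<subseteq> nodes C) \<and> acyclic (edges C)"

definition leaves :: "'a circuit \<Rightarrow> nat set" where
  "leaves C = {v \<in> nodes C. children C v = {}}"

definition circuit_size :: "'a circuit \<Rightarrow> nat" where
  "circuit_size C = card (nodes C)"

inductive computes :: "'a::comm_semiring_1 circuit \<Rightarrow> nat \<Rightarrow> 'a mpoly \<Rightarrow> bool" for C where
  "label C v = Var i \<Longrightarrow> computes C v (pvar i)"
| "label C v = Const c \<Longrightarrow> computes C v (pconst c)"
| "label C v = Plus u w \<Longrightarrow> computes C u p \<Longrightarrow> computes C w q \<Longrightarrow> computes C v (p + q)"
| "label C v = Times u w \<Longrightarrow> computes C u p \<Longrightarrow> computes C w q \<Longrightarrow> computes C v (p * q)"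

definition circuit_poly :: "'a::comm_semiring_1 circuit \<Rightarrow> 'a mpoly" where
  "circuit_poly C = (THE p. computes C (output_node C) p)"

lemma computes_unique: "computes C v p \<Longrightarrow> computes C v q \<Longrightarrow> p = q"
proof (induction arbitrary: q rule: computes.induct)
  case (1 v i)
  from 1(2,1) show ?case by cases auto
next
  case (2 v c)
  from 2(2,1) show ?case by cases auto
next
  case (3 v u w p p')
  from 3(6,1) show ?case by cases (auto dest: 3(4,5))
next
  case (4 v u w p p')
  from 4(6,1) show ?case by cases (auto dest: 4(4,5))
qed

lemma computes_exists:
  assumes "arithmetic_circuit C" "v \<in> nodes C"
  shows "\<exists>p. computes C v p"
proof -
  have "edges C \<subseteq> nodes C \<times> nodes C" "finite (nodes C)"
    using assms(1) unfolding arithmetic_circuit_def edges_def by auto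
  hence "finite (edges C)"
    using finite_subset by blast
  hence "wf (edges C)"
    using assms(1) by (auto simp: arithmetic_circuit_def intro: finite_acyclic_wf)
  thus ?thesis using assms(2)
  proof (induction v rule: wf_induct_rule)
    case (less v)
    have IH: "\<exists>p. computes C u p" if "u \<in> children C v" for u
      using less that assms(1) unfolding arithmetic_circuit_def edges_def by blast
    show ?case
    proof (cases "label C v")
      case (Plus u w)
      hence "u \<in> children C v" "w \<in> children C v" by (auto simp: children_def)
      thus ?thesis using IH computes.intros(3)[OF Plus] by blast
    next
      case (Times u w)
      hence "u \<in> children C v" "w \<in> children C v" by (auto simp: children_def)
      thus ?thesis using IH computes.intros(4)[OF Times] by blast
    qed (use computes.intros(1,2) in blast)+
  qed
qed

lemma computes_circuit_poly:
  assumes "arithmetic_circuit C"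
  shows "computes C (output_node C) (circuit_poly C)"
proof -
  have "output_node C \<in> nodes C"
    using assms by (simp add: arithmetic_circuit_def)
  then obtain p where p: "computes C (output_node C) p"
    using computes_exists[OF assms] by blast
  thus ?thesis
    unfolding circuit_poly_def by (rule theI) (rule computes_unique[OF _ p])
qed

definition monotone_circuit :: "real circuit \<Rightarrow> bool" where
  "monotone_circuit C \<longleftrightarrow> (\<forall>v\<in>nodes C. \<forall>c. label C v = Const c \<longrightarrow> 0 \<le> c)"

text \<open>The layers \<open>V\<^sub>1, \<dots>, V\<^sub>t\<close> are \<open>Vs ! 0, \<dots>, Vs ! (t - 1)\<close> with \<open>t = length Vs\<close>.\<close>

definition layering :: "'a circuit \<Rightarrow> nat set list \<Rightarrow> bool" where
  "layering C Vs \<longleftrightarrow>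
     Vs \<noteq> [] \<and>
     \<Union> (set Vs) = nodes C \<and>
     (\<forall>i<length Vs. Vs ! i \<noteq> {}) \<and>
     (\<forall>i<length Vs. \<forall>j<length Vs. i \<noteq> j \<longrightarrow> Vs ! i \<inter> Vs ! j = {}) \<and>
     Vs ! 0 = leaves C \<and>
     (\<forall>i<length Vs. 0 < i \<longrightarrow> (\<forall>v\<in>Vs ! i. children C v \<subseteq> Vs ! 0 \<union> Vs ! (i - 1)))"

text \<open>The first layer does not count; the maximum over no layers is \<open>0\<close>.\<close>

definition width :: "nat set list \<Rightarrow> nat" where
  "width Vs = Max (insert 0 (card ` set (tl Vs)))"

end

theory Submission
  imports Defs "HOL-Library.Set_Algebras" "HOL-Library.FuncSet" "HOL-Library.Disjoint_Sets"
begin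

text \<open>
  Without cancellation a monotone circuit can be replaced by the sets of monomials computed at
  its nodes. By induction on \<open>k\<close> we show that a circuit of width \<open>k\<close> with at most
  \<open>2 ^ l\<close> layers whose monomials lie in \<open>mon P\<close> covers at most an arbitrarily small
  fraction of \<open>mon P\<close>, once \<open>l\<close> is large.

  For \<open>k = 1\<close> it covers at most one of the \<open>l\<close> monomials. For the step, restrict to one
  summand \<open>Q\<^sub>1 \<cdot> \<dots> \<cdot> Q\<^sub>l\<close> of the outermost sum, each \<open>Q\<^sub>j\<close> being a copy of \<open>P\<close> one level
  down, and sort the monomials by the largest \<open>s\<close> such that some parse tree has all its gates
  above layer \<open>s\<close>; there are at most \<open>2 ^ l\<close> classes. Fix a class and an index \<open>j\<close>. All relevant monomials at a
  node have the same degree in the variables of \<open>Q\<^sub>j\<close>. Let \<open>t > s\<close> be the first layer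
  without a relevant node of degree 0 in them. The class goes through layer \<open>t\<close>, so each of its
  monomials has a factor from a node \<open>w\<close> of that layer. If this factor contains only a proper
  part of the \<open>Q\<^sub>j\<close>-monomial, then \<open>w\<close> fixes the summand of the outermost sum of \<open>Q\<^sub>j\<close>,
  which is a fraction \<open>1 / l\<close> of \<open>Q\<^sub>j\<close>. If it contains all of it, then the projection to
  the variables of \<open>Q\<^sub>j\<close> is computed in smaller width, as every earlier layer has a node that
  projects to a constant, and the induction hypothesis applies. Thus the projection of the class
  to each \<open>Q\<^sub>j\<close> covers at most a quarter of it, and the class at most a fraction \<open>4 ^ (-l)\<close>.
\<close>

section \<open>Monomials and the monomial sets of \<open>P\<close>\<close>

declare One_nat_def [simp del]

abbreviation lookup :: "('a \<Rightarrow>\<^sub>0 'b::zero) \<Rightarrow> 'a \<Rightarrow> 'b" where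
  "lookup \<equiv> Poly_Mapping.lookup"

abbreviation keys :: "('a \<Rightarrow>\<^sub>0 'b::zero) \<Rightarrow> 'a set" where
  "keys \<equiv> Poly_Mapping.keys"

section \<open>Restriction and degree of a monomial in a set of variables\<close>

definition restr :: "nat set \<Rightarrow> monomial \<Rightarrow> monomial" where
  "restr X m = (\<Sum>i\<in>X. Poly_Mapping.single i (lookup m i))"

definition deg :: "nat set \<Rightarrow> monomial \<Rightarrow> nat" where
  "deg X m = (\<Sum>i\<in>X. lookup m i)"

lemma lookup_restr: "finite X \<Longrightarrow> lookup (restr X m) i = (if i \<in> X then lookup m i else 0)"
  by (simp add: restr_def lookup_sum lookup_single when_def)

lemma restr_add: "restr X (a + b) = restr X a + restr X b"
  by (simp add: restr_def lookup_add single_add sum.distrib)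

lemma restr_zero [simp]: "restr X 0 = 0"
  by (simp add: restr_def)

lemma restr_sum: "restr X (sum f I) = (\<Sum>i\<in>I. restr X (f i))"
  by (induction I rule: infinite_finite_induct) (auto simp: restr_add)

lemma deg_add: "deg X (a + b) = deg X a + deg X b"
  by (simp add: deg_def lookup_add sum.distrib)

lemma deg_zero [simp]: "deg X 0 = 0"
  by (simp add: deg_def)

lemma deg_sum: "deg X (sum f I) = (\<Sum>i\<in>I. deg X (f i))"
  by (induction I rule: infinite_finite_induct) (auto simp: deg_add)

lemma deg_single [simp]: "finite X \<Longrightarrow> deg X (Poly_Mapping.single i c) = (if i \<in> X then c else 0)"
  by (simp add: deg_def lookup_single when_def)

lemma keys_plus_monomial: "keys (a + b :: monomial) = keys a \<union> keys b"
  by (auto simp: in_keys_iff lookup_add)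

lemma keys_sum_monomial:
  "finite I \<Longrightarrow> keys (sum f I :: monomial) = (\<Union>i\<in>I. keys (f i))"
  by (induction I rule: finite_induct) (auto simp: keys_plus_monomial)

lemma keys_restr: "finite X \<Longrightarrow> keys (restr X m) = keys m \<inter> X"
  by (auto simp: in_keys_iff lookup_restr split: if_splits)

lemma deg_eq_0_iff: "finite X \<Longrightarrow> deg X m = 0 \<longleftrightarrow> keys m \<inter> X = {}"
  by (auto simp: deg_def in_keys_iff)

lemma restr_eq_0_iff: "finite X \<Longrightarrow> restr X m = 0 \<longleftrightarrow> deg X m = 0"
  by (metis deg_eq_0_iff keys_eq_empty keys_restr)

lemma restr_id: "finite X \<Longrightarrow> keys m \<subseteq> X \<Longrightarrow> restr X m = m"
  by (rule poly_mapping_eqI) (auto simp: lookup_restr in_keys_iff)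

lemma deg_superset: "finite Y \<Longrightarrow> keys m \<subseteq> X \<Longrightarrow> X \<subseteq> Y \<Longrightarrow> deg Y m = deg X m"
  unfolding deg_def by (rule sum.mono_neutral_right) (auto simp: in_keys_iff)

lemma restr_sum_disjoint:
  assumes "finite J" "j \<in> J" "\<And>i. i \<in> J \<Longrightarrow> finite (X i)" "disjoint_family_on X J"
    "\<And>i. i \<in> J \<Longrightarrow> keys (f i) \<subseteq> X i"
  shows "restr (X j) (sum f J) = f j"
proof -
  have "restr (X j) (f i) = (if i = j then f j else 0)" if "i \<in> J" for i
  proof (cases "i = j")
    case True
    thus ?thesis using assms that by (simp add: restr_id)
  next
    case False
    hence "keys (f i) \<inter> X j = {}"
      using assms that by (fastforce simp: disjoint_family_on_def)
    hence "restr (X j) (f i) = 0"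
      using assms by (simp add: restr_eq_0_iff deg_eq_0_iff)
    thus ?thesis using False by simp
  qed
  hence "restr (X j) (sum f J) = (\<Sum>i\<in>J. if i = j then f j else 0)"
    unfolding restr_sum by (intro sum.cong) auto
  thus ?thesis using assms by simp
qed

text \<open>\<open>copyP l k X Q\<close>: up to an injective renaming of the variables, with image \<open>X\<close>,
  \<open>Q\<close> is the set of monomials of \<open>P\<^sub>k\<^sup>l\<close>. Here \<open>P\<^sub>0\<^sup>l\<close> is a single variable.\<close>

inductive copyP :: "nat \<Rightarrow> nat \<Rightarrow> nat set \<Rightarrow> monomial set \<Rightarrow> bool" for l where
  zero: "copyP l 0 {x} {Poly_Mapping.single x 1}"
| Suc: "(\<And>i j. i \<in> {1..l} \<Longrightarrow> j \<in> {1..l} \<Longrightarrow> copyP l k (X i j) (Q i j)) \<Longrightarrow>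
    disjoint_family_on (case_prod X) ({1..l} \<times> {1..l}) \<Longrightarrow>
    copyP l (Suc k) (\<Union>(case_prod X ` ({1..l} \<times> {1..l}))) (\<Union>i\<in>{1..l}. \<Sum>j\<in>{1..l}. Q i j)"

text \<open>The number of monomials of \<open>P\<^sub>k\<^sup>l\<close>, see
  \<open>copyP_card\<close>.\<close>

fun num :: "nat \<Rightarrow> nat \<Rightarrow> nat" where
  "num l 0 = 1"
| "num l (Suc k) = l * num l k ^ l"

lemma num_pos: "l > 0 \<Longrightarrow> num l k > 0"
  by (induction k) auto

lemma mem_set_sum_iff:
  "finite J \<Longrightarrow> m \<in> sum S J \<longleftrightarrow> (\<exists>f. m = sum f J \<and> (\<forall>j\<in>J. f j \<in> S j))"
  for S :: "'b \<Rightarrow> 'a::comm_monoid_add set"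
  by (auto simp: set_sum_alt)

lemma copyP_finite: "copyP l k X Q \<Longrightarrow> finite X \<and> finite Q"
proof (induction rule: copyP.induct)
  case (Suc k X Q)
  have "finite (\<Sum>j\<in>{1..l}. Q i j)" if "i \<in> {1..l}" for i
  proof -
    have "finite (\<Sum>j\<in>J. Q i j)" if "J \<subseteq> {1..l}" for J
      using finite_subset[OF that finite_atLeastAtMost] that \<open>i \<in> {1..l}\<close> Suc
      by (induction J rule: finite_induct) (auto intro!: finite_set_plus)
    thus ?thesis by blast
  qed
  thus ?case using Suc by auto
qed auto

lemma copyP_keys: "copyP l k X Q \<Longrightarrow> m \<in> Q \<Longrightarrow> keys m \<subseteq> X"
proof (induction arbitrary: m rule: copyP.induct)
  case (Suc k X Q)
  then obtain i f where "i \<in> {1..l}" "m = sum f {1..l}" "\<forall>j\<in>{1..l}. f j \<in> Q i j"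
    by (auto simp: mem_set_sum_iff)
  moreover from this have "keys (f j) \<subseteq> X i j" if "j \<in> {1..l}" for j
    using Suc that by blast
  moreover have "keys m = (\<Union>j\<in>{1..l}. keys (f j))"
    using keys_sum_monomial[of "{1..l}" f] calculation(2) by simp
  moreover have "(\<Union>j\<in>{1..l}. X i j) \<subseteq> \<Union>(case_prod X ` ({1..l} \<times> {1..l}))"
    using calculation(1) by force
  moreover have "(\<Union>j\<in>{1..l}. keys (f j)) \<subseteq> (\<Union>j\<in>{1..l}. X i j)"
    using calculation(4) by (rule UN_mono[OF order_refl])
  ultimately show ?case by simp
qed auto

lemma copyP_deg: "copyP l k X Q \<Longrightarrow> m \<in> Q \<Longrightarrow> deg X m = l ^ k"
proof (induction arbitrary: m rule: copyP.induct)
  case (Suc k X Q)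
  then obtain i f where f: "i \<in> {1..l}" "m = sum f {1..l}" "\<forall>j\<in>{1..l}. f j \<in> Q i j"
    by (auto simp: mem_set_sum_iff)
  have fin: "finite (\<Union>(case_prod X ` ({1..l} \<times> {1..l})))"
    using copyP_finite[OF Suc.hyps(1)] by auto
  have "deg (\<Union>(case_prod X ` ({1..l} \<times> {1..l}))) (f j) = l ^ k" if j: "j \<in> {1..l}" for j
  proof -
    have "keys (f j) \<subseteq> X i j"
      using copyP_keys Suc.hyps f j by blast
    hence "deg (\<Union>(case_prod X ` ({1..l} \<times> {1..l}))) (f j) = deg (X i j) (f j)"
      using f j fin by (intro deg_superset) force+
    thus ?thesis using Suc f j by auto
  qed
  thus ?case by (simp add: f deg_sum)
qed auto

text \<open>A product of \<open>l\<close> copies in disjoint variables, that is, one summand of the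
  outermost sum of a copy one level up. Its monomial set is the sumset \<open>sum Q {1..l}\<close>,
  and \<open>restr (X j)\<close> projects it onto the factor \<open>j\<close>.\<close>

locale block =
  fixes l k :: nat and X :: "nat \<Rightarrow> nat set" and Q :: "nat \<Rightarrow> monomial set"
  assumes copy: "j \<in> {1..l} \<Longrightarrow> copyP l k (X j) (Q j)"
    and disj: "disjoint_family_on X {1..l}"
begin

lemma finite_X: "j \<in> {1..l} \<Longrightarrow> finite (X j)"
  using copy copyP_finite by blast

lemma restr_sum_Q:
  assumes "\<forall>j\<in>{1..l}. f j \<in> Q j" "j \<in> {1..l}"
  shows "restr (X j) (sum f {1..l}) = f j"
  proof (rule restr_sum_disjoint)
  show "keys (f i) \<subseteq> X i" if "i \<in> {1..l}" for i
    using that assms(1) copyP_keys[OF copy] by blast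
qed (use assms finite_X disj in auto)

lemma restr_mem: "m \<in> sum Q {1..l} \<Longrightarrow> j \<in> {1..l} \<Longrightarrow> restr (X j) m \<in> Q j"
  by (auto simp: mem_set_sum_iff restr_sum_Q)

lemma keys_block: "m \<in> sum Q {1..l} \<Longrightarrow> keys m \<subseteq> \<Union>(X ` {1..l})"
proof -
  assume "m \<in> sum Q {1..l}"
  then obtain f where f: "m = sum f {1..l}" "\<forall>j\<in>{1..l}. f j \<in> Q j"
    by (auto simp: mem_set_sum_iff)
  hence "keys (f j) \<subseteq> X j" if "j \<in> {1..l}" for j
    using that copyP_keys[OF copy] by blast
  moreover have "keys m = (\<Union>j\<in>{1..l}. keys (f j))"
    using f keys_sum_monomial[of "{1..l}" f] by simp
  ultimately show ?thesis by (simp only: UN_mono)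
qed

lemma deg_restr: "j \<in> {1..l} \<Longrightarrow> deg (X j) (restr (X j) m) = deg (X j) m"
  using finite_X by (auto simp: deg_def lookup_restr intro: sum.cong)

lemma deg_block: "m \<in> sum Q {1..l} \<Longrightarrow> j \<in> {1..l} \<Longrightarrow> deg (X j) m = l ^ k"
  using restr_mem copyP_deg copy deg_restr by metis

lemma eq_if_restr_eq:
  assumes "m \<in> sum Q {1..l}" "m' \<in> sum Q {1..l}"
    "\<And>j. j \<in> {1..l} \<Longrightarrow> restr (X j) m = restr (X j) m'"
  shows "m = m'"
proof -
  have "n = (\<Sum>j\<in>{1..l}. restr (X j) n)" if n: "n \<in> sum Q {1..l}" for n
  proof -
    obtain f where "n = sum f {1..l}" "\<forall>j\<in>{1..l}. f j \<in> Q j"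
      using n by (auto simp: mem_set_sum_iff)
    thus ?thesis using restr_sum_Q[of f] by (auto intro: sum.cong)
  qed
  thus ?thesis using assms by (metis (no_types, lifting) sum.cong)
qed

text \<open>A monomial of the product is determined by its \<open>l\<close> projections, so
  \<open>M\<close> injects into the product of its projected sets.\<close>

lemma card_le:
  fixes c :: real
  assumes "M \<subseteq> sum Q {1..l}" "\<And>j. j \<in> {1..l} \<Longrightarrow> real (card (restr (X j) ` M)) \<le> c"
  shows "real (card M) \<le> c ^ l"
proof -
  let ?g = "\<lambda>m. \<lambda>j\<in>{1..l}. restr (X j) m"
  let ?S = "PiE {1..l} (\<lambda>j. restr (X j) ` M)"
  have fin: "finite (restr (X j) ` M)" if "j \<in> {1..l}" for j
  proof (rule finite_subset)
    show "restr (X j) ` M \<subseteq> Q j" using that assms(1) restr_mem by blast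
    show "finite (Q j)" using that copyP_finite[OF copy] by blast
  qed
  have "inj_on ?g M"
  proof (rule inj_onI)
    fix m m' assume "m \<in> M" "m' \<in> M" "?g m = ?g m'"
    moreover have "restr (X j) m = restr (X j) m'" if "j \<in> {1..l}" for j
    proof -
      have "?g m j = ?g m' j" using \<open>?g m = ?g m'\<close> by (rule fun_cong)
      thus ?thesis unfolding restrict_apply'[OF that] .
    qed
    ultimately show "m = m'" using assms(1) eq_if_restr_eq[of m m'] by (meson subsetD)
  qed
  moreover have "?g ` M \<subseteq> ?S" by auto
  moreover have "finite ?S" using fin by (intro finite_PiE) auto
  ultimately have "card M \<le> card ?S" by (intro card_inj_on_le)
  also have "\<dots> = (\<Prod>j\<in>{1..l}. card (restr (X j) ` M))" by (simp add: card_PiE)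
  finally have "real (card M) \<le> (\<Prod>j\<in>{1..l}. real (card (restr (X j) ` M)))"
    by (metis of_nat_le_iff of_nat_prod)
  also have "\<dots> \<le> (\<Prod>j\<in>{1..l}. c)" using assms(2) by (intro prod_mono) auto
  finally show ?thesis by simp
qed

lemma card_block:
  assumes "\<And>j. j \<in> {1..l} \<Longrightarrow> card (Q j) = n"
  shows "card (sum Q {1..l}) = n ^ l"
proof -
  let ?g = "\<lambda>f. sum f {1..l}"
  have "inj_on ?g (PiE {1..l} Q)"
  proof (rule inj_onI)
    fix f g assume fg: "f \<in> PiE {1..l} Q" "g \<in> PiE {1..l} Q" "sum f {1..l} = sum g {1..l}"
    have "f j = g j" if "j \<in> {1..l}" for j
      using fg(3) that restr_sum_Q[of f j] restr_sum_Q[of g j]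
        PiE_mem[OF fg(1)] PiE_mem[OF fg(2)] by (metis (no_types))
    thus "f = g" using fg by (intro PiE_ext) auto
  qed
  moreover have "?g ` PiE {1..l} Q = sum Q {1..l}"
  proof
    show "?g ` PiE {1..l} Q \<subseteq> sum Q {1..l}"
      by (fastforce simp: mem_set_sum_iff dest: PiE_mem)
    show "sum Q {1..l} \<subseteq> ?g ` PiE {1..l} Q"
    proof
      fix m assume "m \<in> sum Q {1..l}"
      then obtain f where "m = sum f {1..l}" "\<forall>j\<in>{1..l}. f j \<in> Q j"
        by (auto simp: mem_set_sum_iff)
      thus "m \<in> ?g ` PiE {1..l} Q" by (intro image_eqI[of _ _ "restrict f {1..l}"]) auto
    qed
  qed
  ultimately have "card (sum Q {1..l}) = card (PiE {1..l} Q)" by (metis card_image)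
  thus ?thesis using assms by (simp add: card_PiE)
qed

end

lemma copyP_SucE:
  assumes "copyP l (Suc k) X Q"
  obtains Y R where "\<And>i. i \<in> {1..l} \<Longrightarrow> block l k (Y i) (R i)"
    "disjoint_family_on (\<lambda>i. \<Union>j\<in>{1..l}. Y i j) {1..l}"
    "X = \<Union>(case_prod Y ` ({1..l} \<times> {1..l}))" "Q = (\<Union>i\<in>{1..l}. \<Sum>j\<in>{1..l}. R i j)"
  using assms
proof cases
  case (Suc Y R)
  show thesis
  proof (rule that[OF _ _ Suc(1,2)])
    show "block l k (Y i) (R i)" if "i \<in> {1..l}" for i
    proof
      show "copyP l k (Y i j) (R i j)" if "j \<in> {1..l}" for j
        using Suc(3) that \<open>i \<in> {1..l}\<close> by blast
      show "disjoint_family_on (Y i) {1..l}"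
        unfolding disjoint_family_on_def
      proof (intro ballI impI)
        fix j j' assume "j \<in> {1..l}" "j' \<in> {1..l}" "j \<noteq> j'"
        thus "Y i j \<inter> Y i j' = {}"
          using disjoint_family_onD[OF Suc(4), of "(i, j)" "(i, j')"] that by simp
      qed
    qed
    show "disjoint_family_on (\<lambda>i. \<Union>j\<in>{1..l}. Y i j) {1..l}"
      unfolding disjoint_family_on_def
    proof (intro ballI impI)
      fix i i' assume i: "i \<in> {1..l}" "i' \<in> {1..l}" "i \<noteq> i'"
      have "Y i j \<inter> Y i' j' = {}" if "j \<in> {1..l}" "j' \<in> {1..l}" for j j'
        using disjoint_family_onD[OF Suc(4), of "(i, j)" "(i', j')"] i that by simp
      thus "(\<Union>j\<in>{1..l}. Y i j) \<inter> (\<Union>j\<in>{1..l}. Y i' j) = {}" by blast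
    qed
  qed
qed

text \<open>Different summands of the outermost sum have disjoint sets of variables.\<close>

lemma copyP_same_block:
  assumes "\<And>i. i \<in> {1..l} \<Longrightarrow> block l k (Y i) (R i)"
    "disjoint_family_on (\<lambda>i. \<Union>j\<in>{1..l}. Y i j) {1..l}"
    "i \<in> {1..l}" "i' \<in> {1..l}" "m \<in> (\<Sum>j\<in>{1..l}. R i j)" "m' \<in> (\<Sum>j\<in>{1..l}. R i' j)"
    "keys m \<inter> keys m' \<noteq> {}"
  shows "i = i'"
proof (rule ccontr)
  assume "i \<noteq> i'"
  have "keys m \<subseteq> (\<Union>j\<in>{1..l}. Y i j)" "keys m' \<subseteq> (\<Union>j\<in>{1..l}. Y i' j)"
    using block.keys_block[OF assms(1)] assms by blast+
  moreover have "(\<Union>j\<in>{1..l}. Y i j) \<inter> (\<Union>j\<in>{1..l}. Y i' j) = {}"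
    using assms(2-4) \<open>i \<noteq> i'\<close> unfolding disjoint_family_on_def by blast
  ultimately show False using assms(7) by blast
qed

lemma copyP_card: "copyP l k X Q \<Longrightarrow> card Q = num l k"
proof (induction k arbitrary: X Q)
  case 0
  thus ?case by cases auto
next
  case (Suc k)
  obtain Y R where YR: "\<And>i. i \<in> {1..l} \<Longrightarrow> block l k (Y i) (R i)"
    "disjoint_family_on (\<lambda>i. \<Union>j\<in>{1..l}. Y i j) {1..l}"
    "X = \<Union>(case_prod Y ` ({1..l} \<times> {1..l}))" "Q = (\<Union>i\<in>{1..l}. \<Sum>j\<in>{1..l}. R i j)"
    using copyP_SucE[OF Suc.prems] by metis
  have card: "card (\<Sum>j\<in>{1..l}. R i j) = num l k ^ l" if "i \<in> {1..l}" for i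
    using block.card_block[OF YR(1)[OF that]] Suc.IH block.copy[OF YR(1)[OF that]] by blast
  have fin: "finite (\<Sum>j\<in>{1..l}. R i j)" if "i \<in> {1..l}" for i
    using copyP_finite[OF Suc.prems] that unfolding YR(4) by (auto intro: finite_subset)
  have "(\<Sum>j\<in>{1..l}. R i j) \<inter> (\<Sum>j\<in>{1..l}. R i' j) = {}"
    if "i \<in> {1..l}" "i' \<in> {1..l}" "i \<noteq> i'" for i i'
  proof (rule ccontr)
    assume "\<not> ?thesis"
    then obtain m where m: "m \<in> (\<Sum>j\<in>{1..l}. R i j)" "m \<in> (\<Sum>j\<in>{1..l}. R i' j)"
      by blast
    \<comment> \<open>A monomial of positive degree shares a variable with itself, so it cannot lie
      in two summands.\<close>
    hence "deg (Y i 1) m = l ^ k"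
      using that block.deg_block[OF YR(1)[OF that(1)]] by auto
    hence "m \<noteq> 0" using that by (intro notI) simp
    hence "keys m \<inter> keys m \<noteq> {}" by simp
    thus False using copyP_same_block[OF YR(1,2) that(1,2) m] that by blast
  qed
  hence "card Q = (\<Sum>i\<in>{1..l}. card (\<Sum>j\<in>{1..l}. R i j))"
    unfolding YR(4) using fin by (intro card_UN_disjoint) auto
  thus ?case using card by simp
qed

text \<open>A product of two sets of nonconstant monomials inside \<open>mon P\<close> stays within one summand
  of the outermost sum; \<open>a\<close> is an element of the first factor.\<close>

lemma copyP_split_card:
  assumes Q: "copyP l (Suc k) X Q" and "R \<subseteq> Q" "a \<noteq> 0"
    and split: "\<And>m. m \<in> R \<Longrightarrow> \<exists>b c. b \<noteq> 0 \<and> a + b \<in> Q \<and> m = c + b"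
  shows "l * card R \<le> num l (Suc k)"
proof (cases "R = {}")
  case False
  obtain Y S where YS: "\<And>i. i \<in> {1..l} \<Longrightarrow> block l k (Y i) (S i)"
    "disjoint_family_on (\<lambda>i. \<Union>j\<in>{1..l}. Y i j) {1..l}"
    "X = \<Union>(case_prod Y ` ({1..l} \<times> {1..l}))" "Q = (\<Union>i\<in>{1..l}. \<Sum>j\<in>{1..l}. S i j)"
    using copyP_SucE[OF Q] by metis
  have same: "i = i'" if "i \<in> {1..l}" "i' \<in> {1..l}" "m \<in> (\<Sum>j\<in>{1..l}. S i j)"
    "m' \<in> (\<Sum>j\<in>{1..l}. S i' j)" "keys m \<inter> keys m' \<noteq> {}" for i i' m m'
    using copyP_same_block[OF _ YS(2) that] YS(1) by blast
  obtain b0 where "a + b0 \<in> Q" using split False by blast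
  then obtain i where i: "i \<in> {1..l}" "a + b0 \<in> (\<Sum>j\<in>{1..l}. S i j)"
    using YS(4) by blast
  have "R \<subseteq> (\<Sum>j\<in>{1..l}. S i j)"
  proof
    fix m assume m: "m \<in> R"
    then obtain b c where bc: "b \<noteq> 0" "a + b \<in> Q" "m = c + b" using split by blast
    obtain i' where i': "i' \<in> {1..l}" "m \<in> (\<Sum>j\<in>{1..l}. S i' j)"
      using m \<open>R \<subseteq> Q\<close> YS(4) by blast
    obtain i'' where i'': "i'' \<in> {1..l}" "a + b \<in> (\<Sum>j\<in>{1..l}. S i'' j)"
      using bc YS(4) by blast
    \<comment> \<open>\<open>a + b\<close> meets \<open>a + b0\<close> in the variables of
      \<open>a\<close> and meets \<open>m\<close> in those of \<open>b\<close>, so all three lie in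
      the same summand.\<close>
    have "i'' = i" 
    proof (rule same[OF i''(1) i(1) i''(2) i(2)])
      show "keys (a + b) \<inter> keys (a + b0) \<noteq> {}"
        using \<open>a \<noteq> 0\<close> keys_eq_empty[of a] by (auto simp only: keys_plus_monomial)
    qed
    moreover have "i'' = i'" 
    proof (rule same[OF i''(1) i'(1) i''(2) i'(2)])
      show "keys (a + b) \<inter> keys m \<noteq> {}"
        using bc keys_eq_empty[of b] by (auto simp only: keys_plus_monomial)
    qed
    ultimately show "m \<in> (\<Sum>j\<in>{1..l}. S i j)" using i' by simp
  qed
  moreover have "finite (\<Sum>j\<in>{1..l}. S i j)"
    using copyP_finite[OF Q] i unfolding YS(4) by (auto intro: finite_subset)
  ultimately have "card R \<le> card (\<Sum>j\<in>{1..l}. S i j)" by (rule card_mono[rotated])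
  also have "\<dots> = num l k ^ l"
    using block.card_block[OF YS(1)[OF i(1)]] copyP_card block.copy[OF YS(1)[OF i(1)]] by blast
  finally show ?thesis by simp
qed simp

section \<open>Sequences of bounded width\<close>

text \<open>The monomial sets of the constant zero, of a nonzero constant and of a variable.\<close>

definition leafset :: "monomial set \<Rightarrow> bool" where
  "leafset L \<longleftrightarrow> L = {} \<or> L = {0} \<or> (\<exists>i. L = {Poly_Mapping.single i 1})"

text \<open>A leaf carries its monomial set instead of a node name: leaves are usable from every
  layer without counting for the width, and a node whose projection becomes constant can be turned
  into a leaf.\<close>

datatype operand = Leaf "monomial set" | Node nat

fun admissible :: "nat set \<Rightarrow> operand \<Rightarrow> bool" where
  "admissible I (Leaf L) = leafset L"
| "admissible I (Node u) = (u \<in> I)"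

fun operand_val :: "(nat \<Rightarrow> monomial set) \<Rightarrow> operand \<Rightarrow> monomial set" where
  "operand_val f (Leaf L) = L"
| "operand_val f (Node u) = f u"

fun gate_val :: "bool \<Rightarrow> monomial set \<Rightarrow> monomial set \<Rightarrow> monomial set" where
  "gate_val True A B = A \<union> B"
| "gate_val False A B = A + B"

text \<open>The monomial sets \<open>F t v\<close>, \<open>v \<in> I t\<close>, arise in a layered monotone circuit of width at
  most \<open>k\<close>. Input nodes are not part of the layers, so \<open>I 0\<close> is empty; the output is the
  only node of layer \<open>T\<close>.\<close>

definition width_seq ::
  "nat \<Rightarrow> (nat \<Rightarrow> nat set) \<Rightarrow> (nat \<Rightarrow> nat \<Rightarrow> monomial set) \<Rightarrow> nat \<Rightarrow> nat \<Rightarrow> bool" where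
  "width_seq k I F T r \<longleftrightarrow>
     I 0 = {} \<and> I T = {r} \<and> (\<forall>t\<le>T. finite (I t) \<and> card (I t) \<le> k) \<and>
     (\<forall>t<T. \<forall>v\<in>I (Suc t). \<exists>g x y. admissible (I t) x \<and> admissible (I t) y \<and>
        F (Suc t) v = gate_val g (operand_val (F t) x) (operand_val (F t) y))"

lemma width_seq_gate:
  assumes "width_seq k I F T r" "t < T" "v \<in> I (Suc t)"
  obtains g x y where "admissible (I t) x" "admissible (I t) y"
    "F (Suc t) v = gate_val g (operand_val (F t) x) (operand_val (F t) y)"
  using assms unfolding width_seq_def by metis

text \<open>\<open>g t v\<close>, \<open>x t v\<close> and \<open>y t v\<close> describe the gate at
  node \<open>v\<close> of layer \<open>Suc t\<close>. Emptying all layers up to \<open>s\<close>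
  leaves the monomials of those parse trees whose gates all lie above layer \<open>s\<close>; leaf
  operands stay available everywhere.\<close>

primrec run ::
  "(nat \<Rightarrow> nat \<Rightarrow> bool) \<Rightarrow> (nat \<Rightarrow> nat \<Rightarrow> operand) \<Rightarrow> (nat \<Rightarrow> nat \<Rightarrow> operand) \<Rightarrow> nat \<Rightarrow>
     nat \<Rightarrow> nat \<Rightarrow> monomial set" where
  "run g x y s 0 v = {}"
| "run g x y s (Suc t) v = (if t < s then {} else
     gate_val (g t v) (operand_val (run g x y s t) (x t v)) (operand_val (run g x y s t) (y t v)))"

lemma run_le: "t \<le> s \<Longrightarrow> run g x y s t v = {}"
  by (cases t) auto

lemma operand_val_mono:
  "(\<And>u. f u \<subseteq> f' u) \<Longrightarrow> operand_val f x \<subseteq> operand_val f' x"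
  by (cases x) auto

lemma gate_val_mono: "A \<subseteq> A' \<Longrightarrow> B \<subseteq> B' \<Longrightarrow> gate_val b A B \<subseteq> gate_val b A' B'"
  by (cases b) (auto dest: set_plus_mono2)

lemma run_antimono: "s \<le> s' \<Longrightarrow> run g x y s' t v \<subseteq> run g x y s t v"
proof (induction t arbitrary: v)
  case (Suc t)
  hence "gate_val (g t v) (operand_val (run g x y s' t) (x t v)) (operand_val (run g x y s' t) (y t v))
    \<subseteq> gate_val (g t v) (operand_val (run g x y s t) (x t v)) (operand_val (run g x y s t) (y t v))"
    by (intro gate_val_mono operand_val_mono)
  thus ?case using Suc.prems by auto
qed simp

text \<open>A parse tree of \<open>m\<close> with all gates above \<open>s\<close> must have a gate
  in layer \<open>s'\<close> or below. As operands that are not leaves come from the adjacent layer,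
  the tree passes through a node \<open>w\<close> of layer \<open>s'\<close>. Here \<open>a\<close>
  is the monomial of the subtree at \<open>w\<close> and \<open>c\<close> that of the rest; any
  other monomial of \<open>w\<close> may replace \<open>a\<close>.\<close>

lemma run_crossing:
  assumes "s \<le> s'" "s' \<le> t" "t \<le> T"
    and adm: "\<And>t v. t < T \<Longrightarrow> v \<in> I (Suc t) \<Longrightarrow> admissible (I t) (x t v) \<and> admissible (I t) (y t v)"
    and "v \<in> I t" "m \<in> run g x y s t v" "m \<notin> run g x y s' t v"
  shows "\<exists>w\<in>I s'. \<exists>a\<in>run g x y s s' w. \<exists>c. m = a + c \<and> (\<forall>a'\<in>run g x y s s' w. a' + c \<in> run g x y s t v)"
  using assms(2,3,5-)
proof (induction t arbitrary: v m rule: dec_induct)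
  case base
  thus ?case by (intro bexI[of _ v] bexI[of _ m] exI[of _ 0]) auto
next
  case (step t)
  let ?F = "run g x y s t" and ?F' = "run g x y s' t"
  let ?C = "\<lambda>S z. \<exists>w\<in>I s'. \<exists>a\<in>run g x y s s' w. \<exists>c. z = a + c \<and> (\<forall>a'\<in>run g x y s s' w. a' + c \<in> S)"
  \<comment> \<open>A leaf operand has the same value in both runs, so a lost monomial comes from a
    node, where the induction hypothesis applies.\<close>
  have op: "?C (operand_val ?F o') z"
    if "admissible (I t) o'" "z \<in> operand_val ?F o'" "z \<notin> operand_val ?F' o'" for o' z
    using that step by (cases o') auto
  define A where "A = operand_val ?F (x t v)"
  define B where "B = operand_val ?F (y t v)"
  define A' where "A' = operand_val ?F' (x t v)"
  define B' where "B' = operand_val ?F' (y t v)"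
  have A: "?C A z" if "z \<in> A" "z \<notin> A'" for z
    using op[of "x t v" z] adm[of t v] that step.prems unfolding A_def A'_def by simp
  have B: "?C B z" if "z \<in> B" "z \<notin> B'" for z
    using op[of "y t v" z] adm[of t v] that step.prems unfolding B_def B'_def by simp
  have val: "run g x y s (Suc t) v = gate_val (g t v) A B"
    "run g x y s' (Suc t) v = gate_val (g t v) A' B'"
    using \<open>s' \<le> t\<close> \<open>s \<le> s'\<close> by (simp_all add: A_def B_def A'_def B'_def)
  show ?case
  proof (cases "g t v")
    case True
    hence eq: "run g x y s (Suc t) v = A \<union> B" "run g x y s' (Suc t) v = A' \<union> B'"
      using val by auto
    hence "?C A m \<or> ?C B m" using step.prems A B by blast
    thus ?thesis unfolding eq by blast
  next
    case False
    hence eq: "run g x y s (Suc t) v = A + B" "run g x y s' (Suc t) v = A' + B'"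
      using val by auto
    obtain p q where pq: "m = p + q" "p \<in> A" "q \<in> B"
      using step.prems unfolding eq by (auto elim: set_plus_elim)
    hence "p \<notin> A' \<or> q \<notin> B'" using step.prems unfolding eq by auto
    thus ?thesis
    proof
      assume "p \<notin> A'"
      then obtain w a c where w: "w \<in> I s'" "a \<in> run g x y s s' w" "p = a + c"
        "\<forall>a'\<in>run g x y s s' w. a' + c \<in> A" using A pq by blast
      show ?thesis unfolding eq
        by (rule bexI[OF _ w(1)], rule bexI[OF _ w(2)], rule exI[of _ "c + q"])
          (use w pq in \<open>auto simp: add.assoc[symmetric]\<close>)
    next
      assume "q \<notin> B'"
      then obtain w a c where w: "w \<in> I s'" "a \<in> run g x y s s' w" "q = a + c"
        "\<forall>a'\<in>run g x y s s' w. a' + c \<in> B" using B pq by blast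
      show ?thesis unfolding eq
        by (rule bexI[OF _ w(1)], rule bexI[OF _ w(2)], rule exI[of _ "p + c"])
          (use w pq in \<open>auto simp: add.left_commute[of _ p] intro!: set_plus_intro\<close>)
    qed
  qed
qed

section \<open>Leaves and gates under restriction to a set of variables\<close>

lemma leafset_restr: "finite X \<Longrightarrow> leafset L \<Longrightarrow> leafset (restr X ` L)"
proof (unfold leafset_def, elim disjE exE)
  fix i assume "finite X" "L = {Poly_Mapping.single i 1}"
  moreover have "restr X (Poly_Mapping.single i 1) = (if i \<in> X then Poly_Mapping.single i 1 else 0)"
    using \<open>finite X\<close> by (intro poly_mapping_eqI) (auto simp: lookup_restr lookup_single when_def)
  ultimately show "restr X ` L = {} \<or> restr X ` L = {0} \<or> (\<exists>i. restr X ` L = {Poly_Mapping.single i 1})"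
    by auto
qed auto

lemma leafset_filter: "leafset L \<Longrightarrow> leafset {m \<in> L. p m}"
  unfolding leafset_def by (elim disjE exE) auto

lemma restr_image_plus: "restr X ` (A + B) = restr X ` A + restr X ` B"
  by (auto simp: set_plus_image image_image restr_add image_iff) (metis restr_add)+

lemma restr_image_gate_val: "restr X ` gate_val b A B = gate_val b (restr X ` A) (restr X ` B)"
  by (cases b) (auto simp: restr_image_plus image_Un)

text \<open>Setting the variables outside \<open>X\<close> to zero respects the gates exactly: a
  product survives iff both of its factors do.\<close>

lemma width_seq_filter_keys:
  assumes "width_seq k I F T r"
  shows "width_seq k I (\<lambda>t v. {m \<in> F t v. keys m \<subseteq> X}) T r"
proof -
  define f where "f = (\<lambda>A :: monomial set. {m \<in> A. keys m \<subseteq> X})"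
  have gate: "f (gate_val b A B) = gate_val b (f A) (f B)" for b A B
    by (cases b) (fastforce simp: f_def set_plus_def keys_plus_monomial)+
  have "\<exists>g x y. admissible (I t) x \<and> admissible (I t) y \<and>
      f (F (Suc t) v) = gate_val g (operand_val (\<lambda>u. f (F t u)) x) (operand_val (\<lambda>u. f (F t u)) y)"
    if tv: "t < T" "v \<in> I (Suc t)" for t v
  proof -
    obtain g x y where gxy: "admissible (I t) x" "admissible (I t) y"
      "F (Suc t) v = gate_val g (operand_val (F t) x) (operand_val (F t) y)"
      using width_seq_gate[OF assms tv] .
    define h where "h = (\<lambda>x. case x of Leaf L \<Rightarrow> Leaf (f L) | Node u \<Rightarrow> Node u)"
    have "admissible (I t) (h x)" if "admissible (I t) x" for x
      using that leafset_filter by (cases x) (auto simp: h_def f_def)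
    moreover have "operand_val (\<lambda>u. f (F t u)) (h x) = f (operand_val (F t) x)" for x
      by (cases x) (auto simp: h_def)
    ultimately show ?thesis using gxy gate by metis
  qed
  thus ?thesis using assms unfolding width_seq_def f_def by simp
qed

section \<open>Circuits of width one\<close>

lemma leafset_deg: "leafset L \<Longrightarrow> m \<in> L \<Longrightarrow> finite X \<Longrightarrow> deg X m \<le> 1"
  unfolding leafset_def by auto

lemma leafset_unique: "leafset L \<Longrightarrow> m \<in> L \<Longrightarrow> m' \<in> L \<Longrightarrow> m = m'"
  unfolding leafset_def by auto

text \<open>At level 1 each summand of the outermost sum is a single monomial, and different
  summands share no variable.\<close>

lemma copyP_1_eqI:
  assumes Q: "copyP l 1 X Q" and m: "m \<in> Q" "m' \<in> Q" "keys m \<inter> keys m' \<noteq> {}"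
  shows "m = m'"
proof -
  obtain Y R where YR: "\<And>i. i \<in> {1..l} \<Longrightarrow> block l 0 (Y i) (R i)"
    "disjoint_family_on (\<lambda>i. \<Union>j\<in>{1..l}. Y i j) {1..l}"
    "Q = (\<Union>i\<in>{1..l}. \<Sum>j\<in>{1..l}. R i j)"
    using copyP_SucE[of l 0 X Q] Q unfolding One_nat_def by metis
  obtain i i' where i: "i \<in> {1..l}" "m \<in> (\<Sum>j\<in>{1..l}. R i j)"
      "i' \<in> {1..l}" "m' \<in> (\<Sum>j\<in>{1..l}. R i' j)"
    using m YR(3) by blast
  have "i = i'"
    using copyP_same_block[OF _ YR(2) i(1,3,2,4) m(3)] YR(1) by blast
  have "restr (Y i j) m = restr (Y i j) m'" if j: "j \<in> {1..l}" for j
  proof -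
    have "copyP l 0 (Y i j) (R i j)" using block.copy[OF YR(1)[OF i(1)] j] .
    hence "\<exists>z. R i j = {z}" by cases auto
    thus ?thesis
      using block.restr_mem[OF YR(1)[OF i(1)] i(2) j] block.restr_mem[OF YR(1)[OF i(1)] _ j, of m'] i(4)
        \<open>i = i'\<close> by auto
  qed
  thus ?thesis
    using block.eq_if_restr_eq[OF YR(1)[OF i(1)] i(2)] i(4) \<open>i = i'\<close> by blast
qed

text \<open>With one node per layer, a sum gate inside \<open>Q\<close> cannot merge two different
  nonempty sets, as leaves have degree at most 1. At a product gate, a nonconstant element of one
  factor determines the other factor, because any two products with it share a variable.\<close>

lemma width_one_unique:
  assumes "copyP l 1 X Q" "l \<ge> 2" "width_seq 1 I F T r" "t \<le> T" "v \<in> I t"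
    "F t v \<subseteq> Q" "m \<in> F t v" "m' \<in> F t v"
  shows "m = m'"
  using assms(4-)
proof (induction t arbitrary: v m m')
  case 0
  thus ?case using assms(3) by (simp add: width_seq_def)
next
  case (Suc t)
  note finX = conjunct1[OF copyP_finite[OF assms(1)]]
  have deg: "deg X q = l" if "q \<in> Q" for q
    using copyP_deg[OF assms(1) that] by simp
  obtain g x y where gxy: "admissible (I t) x" "admissible (I t) y"
      "F (Suc t) v = gate_val g (operand_val (F t) x) (operand_val (F t) y)"
    using width_seq_gate[OF assms(3)] Suc.prems by (metis Suc_le_lessD)
  define A where "A = operand_val (F t) x"
  define B where "B = operand_val (F t) y"
  have IH: "p = q" if "admissible (I t) z" "operand_val (F t) z \<subseteq> Q"
    "p \<in> operand_val (F t) z" "q \<in> operand_val (F t) z" for z p q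
    using that Suc.IH[of _ p q] Suc.prems leafset_unique by (cases z) auto
  have leaf: "\<exists>u\<in>I t. z = Node u" if z: "admissible (I t) z" "operand_val (F t) z \<subseteq> Q"
    "operand_val (F t) z \<noteq> {}" for z
  proof (cases z)
    case (Leaf L)
    then obtain p where "p \<in> L" "leafset L" "p \<in> Q" using z by fastforce
    thus ?thesis using leafset_deg[OF _ _ finX, of L p] deg[of p] \<open>l \<ge> 2\<close> by simp
  qed (use z in auto)
  show ?case
  proof (cases g)
    case True
    hence F: "F (Suc t) v = A \<union> B" using gxy by (simp add: A_def B_def)
    have "card (I t) \<le> 1" "finite (I t)" using assms(3) Suc.prems by (auto simp: width_seq_def)
    hence one: "u = u'" if "u \<in> I t" "u' \<in> I t" for u u'
      using that card_le_Suc0_iff_eq by (metis One_nat_def)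
    have "A = {} \<or> B = {} \<or> A = B"
    proof (rule ccontr)
      assume neq: "\<not> ?thesis"
      have "A \<subseteq> Q" "B \<subseteq> Q" using F Suc.prems by auto
      then obtain u u' where "u \<in> I t" "u' \<in> I t" "x = Node u" "y = Node u'"
        using leaf[of x] leaf[of y] gxy neq unfolding A_def B_def by blast
      thus False using one[of u u'] neq unfolding A_def B_def by simp
    qed
    hence "A \<union> B = A \<or> A \<union> B = B" by blast
    thus ?thesis using IH[of x m m'] IH[of y m m'] gxy F Suc.prems unfolding A_def B_def by metis
  next
    case False
    hence F: "F (Suc t) v = A + B" using gxy by (simp add: A_def B_def)
    obtain a b a' b' where ab: "m = a + b" "m' = a' + b'" "a \<in> A" "b \<in> B" "a' \<in> A" "b' \<in> B"
      using Suc.prems unfolding F by (auto elim!: set_plus_elim)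
    have A: "p = p'" if "p \<in> A" "p' \<in> A" "q \<in> B" "q \<noteq> 0" for p p' q
    proof -
      have "p + q \<in> Q" "p' + q \<in> Q" using that Suc.prems F by auto
      moreover have "keys (p + q) \<inter> keys (p' + q) \<noteq> {}"
        using that(4) keys_eq_empty[of q] unfolding keys_plus_monomial by blast
      ultimately have "p + q = p' + q" by (rule copyP_1_eqI[OF assms(1)])
      thus ?thesis by simp
    qed
    have B: "p = p'" if "p \<in> B" "p' \<in> B" "q \<in> A" "q \<noteq> 0" for p p' q
    proof -
      have "q + p \<in> Q" "q + p' \<in> Q" using that Suc.prems F by auto
      moreover have "keys (q + p) \<inter> keys (q + p') \<noteq> {}"
        using that(4) keys_eq_empty[of q] unfolding keys_plus_monomial by blast
      ultimately have "q + p = q + p'" by (rule copyP_1_eqI[OF assms(1)])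
      thus ?thesis by simp
    qed
    \<comment> \<open>If one factor contains only the constant monomial, the other lies in
      \<open>Q\<close> and the induction hypothesis applies. Otherwise the facts \<open>A\<close>
      and \<open>B\<close> determine both factors.\<close>
    have "D = {0} \<or> (\<exists>q\<in>D. q \<noteq> 0)" if "z \<in> D" for z :: monomial and D
      using that by auto
    from this[OF ab(3)] this[OF ab(4)]
    consider "B = {0}" | "A = {0}" | "\<exists>q\<in>B. q \<noteq> 0" "\<exists>q\<in>A. q \<noteq> 0"
      by argo
    thus ?thesis
    proof cases
      case 1
      hence "A \<subseteq> Q" using F Suc.prems by simp
      thus ?thesis using IH[of x a a'] gxy ab 1 unfolding A_def by simp
    next
      case 2
      hence "B \<subseteq> Q" using F Suc.prems by simp
      thus ?thesis using IH[of y b b'] gxy ab 2 unfolding B_def by simp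
    next
      case 3
      hence "a = a'" "b = b'" using A[OF ab(3,5)] B[OF ab(4,6)] by blast+
      thus ?thesis using ab by simp
    qed
  qed
qed

section \<open>Reducing the width\<close>

text \<open>\<open>2 ^ l\<close> bounds the number of classes, and the exponent \<open>l\<close>
  collects the projections to the factors. Each projection of a class is covered by the at most
  \<open>Suc n\<close> nodes of a critical layer; each node contributes a fraction at most
  \<open>e\<close>, by \<open>IH\<close> for width \<open>n\<close> or because \<open>1 / l\<close>
  is at most \<open>e\<close>.\<close>

lemma (in block) width_step:
  fixes e :: real
  assumes "k > 0" "l > 0" "n > 0" "1 / real l \<le> e"
    and IH: "\<And>Y R I F T r. copyP l k Y R \<Longrightarrow> width_seq n I F T r \<Longrightarrow> T \<le> 2 ^ l \<Longrightarrow> F T r \<subseteq> R \<Longrightarrow>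
      real (card (F T r)) \<le> e * real (num l k)"
    and ws: "width_seq (Suc n) I F T r" and T: "T \<le> 2 ^ l" and sub: "F T r \<subseteq> sum Q {1..l}"
  shows "real (card (F T r)) \<le> 2 ^ l * (real (Suc n) * e * real (num l k)) ^ l"
proof -
  have e0: "e \<ge> 0"
    using assms(4) by (meson divide_nonneg_nonneg of_nat_0_le_iff order_trans zero_le_one)
  \<comment> \<open>The gates are chosen once, so that the same circuit can be rerun with its lower
    layers emptied.\<close>
  have "\<forall>t v. \<exists>g x y. t < T \<longrightarrow> v \<in> I (Suc t) \<longrightarrow> admissible (I t) x \<and> admissible (I t) y \<and>
      F (Suc t) v = gate_val g (operand_val (F t) x) (operand_val (F t) y)"
    using width_seq_gate[OF ws] by metis
  then obtain g x y where "\<forall>t v. t < T \<longrightarrow> v \<in> I (Suc t) \<longrightarrow>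
      admissible (I t) (x t v) \<and> admissible (I t) (y t v) \<and>
      F (Suc t) v = gate_val (g t v) (operand_val (F t) (x t v)) (operand_val (F t) (y t v))"
    by metis
  hence adm: "admissible (I t) (x t v) \<and> admissible (I t) (y t v)"
    and val: "F (Suc t) v = gate_val (g t v) (operand_val (F t) (x t v)) (operand_val (F t) (y t v))"
    if "t < T" "v \<in> I (Suc t)" for t v
    using that by blast+
  define G where "G = run g x y"
  define S where "S = sum Q {1..l}"
  \<comment> \<open>The class of monomials for which \<open>s\<close> is the largest value admitting
    a parse tree with all gates above layer \<open>s\<close>.\<close>
  define M where "M = (\<lambda>s. G s T r - G (Suc s) T r)"
  have IT: "I T = {r}" and I0: "I 0 = {}"
    using ws by (auto simp: width_seq_def)
  have finI: "finite (I t)" "card (I t) \<le> Suc n" if "t \<le> T" for t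
    using ws that by (auto simp: width_seq_def)
  have G0: "G 0 t v = F t v" if "t \<le> T" "v \<in> I t" for t v
    using that
  proof (induction t arbitrary: v)
    case (Suc t)
    have "operand_val (G 0 t) z = operand_val (F t) z" if "admissible (I t) z" for z
      using that Suc by (cases z) auto
    thus ?case using adm[of t v] val[of t v] Suc.prems by (simp add: G_def)
  qed (use I0 in auto)
  have GS: "G s T r \<subseteq> S" for s
    using run_antimono[of 0 s g x y T r] G0[of T r] IT sub by (auto simp: G_def S_def)
  have cov: "F T r \<subseteq> (\<Union>s<T. M s)"
  proof
    fix m assume "m \<in> F T r"
    hence m0: "m \<in> G 0 T r" using G0[of T r] IT by simp
    have mT: "m \<notin> G T T r" by (simp add: G_def run_le)
    \<comment> \<open>The first run without \<open>m\<close> is at most \<open>T\<close>, where the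
      output is empty, and is not run 0, which is the whole circuit.\<close>
    define s where "s = (LEAST s. m \<notin> G s T r)"
    have s: "m \<notin> G s T r" "s \<le> T"
      unfolding s_def using mT by (rule LeastI, rule Least_le)
    then obtain s' where s': "s = Suc s'" using m0 by (cases s) auto
    hence "m \<in> G s' T r" using not_less_Least[of s' "\<lambda>s. m \<notin> G s T r"] s_def by auto
    thus "m \<in> (\<Union>s<T. M s)" using s s' by (auto simp: M_def)
  qed
  have Mj: "real (card (restr (X j) ` M s)) \<le> real (Suc n) * e * real (num l k)"
    if s: "s < T" and j: "j \<in> {1..l}" for s j
  proof (cases "M s = {}")
    case True
    thus ?thesis using True e0 by simp
  next
    case False
    note finj = finite_X[OF j]
    have finQ: "finite (Q j)" using copyP_finite[OF copy[OF j]] by blast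
    \<comment> \<open>\<open>ext\<close> marks the relevant nodes: a single \<open>b\<close>
      completes all their monomials to elements of \<open>S\<close>, so these have equal degree in
      \<open>X j\<close>. \<open>triv\<close> marks the nodes that project to a constant.\<close>
    define ext where "ext = (\<lambda>A. A \<noteq> {} \<and> (\<exists>b. \<forall>a\<in>A. a + b \<in> S))"
    define triv where "triv = (\<lambda>A. restr (X j) ` A = {0})"
    define P where "P = (\<lambda>t. s < t \<and> \<not> (\<exists>w\<in>I t. ext (G s t w) \<and> triv (G s t w)))"
    have degS: "deg (X j) m = l ^ k" if "m \<in> S" for m
      using that deg_block j by (simp add: S_def)
    have resS: "restr (X j) m \<in> Q j" if "m \<in> S" for m
      using that restr_mem j by (simp add: S_def)
    have PT: "P T"
    proof -
      obtain m where m: "m \<in> G s T r" using False by (auto simp: M_def)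
      hence "deg (X j) m \<noteq> 0" using GS degS \<open>l > 0\<close> by fastforce
      hence "restr (X j) m \<noteq> 0" using restr_eq_0_iff[OF finj] by simp
      hence "\<not> triv (G s T r)" using m by (auto simp: triv_def)
      thus ?thesis using s IT by (auto simp: P_def)
    qed
    \<comment> \<open>The critical layer: by minimality, every layer strictly between
      \<open>s\<close> and \<open>t\<close> has a relevant node that projects to a constant.\<close>
    define t where "t = (LEAST t. P t)"
    have Pt: "P t" and tT: "t \<le> T" and Pless: "\<And>t'. t' < t \<Longrightarrow> \<not> P t'"
      unfolding t_def using PT by (auto intro: LeastI Least_le dest: not_less_Least)
    have st: "s < t" using Pt by (simp add: P_def)
    \<comment> \<open>Projections of the monomials routed through \<open>w\<close>. The context
      \<open>c\<close> has to fit every monomial of \<open>w\<close>, as \<open>run_crossing\<close>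
      provides.\<close>
    define R where "R = (\<lambda>w. {restr (X j) (a + c) | a c. a \<in> G s t w \<and> (\<forall>a'\<in>G s t w. a' + c \<in> S)})"
    have "restr (X j) ` M s \<subseteq> (\<Union>w\<in>I t. R w)"
    proof
      fix z assume "z \<in> restr (X j) ` M s"
      then obtain m where m: "z = restr (X j) m" "m \<in> G s T r" "m \<notin> G (Suc s) T r"
        by (auto simp: M_def)
      \<comment> \<open>As \<open>m\<close> is already lost at \<open>Suc s \<le> t\<close>, it is
        absent from run \<open>t\<close>, and its parse trees above layer \<open>s\<close> cross
        layer \<open>t\<close>.\<close>
      hence "m \<notin> G t T r" using run_antimono[of "Suc s" t g x y T r] st by (auto simp: G_def)
      hence "\<exists>w\<in>I t. \<exists>a\<in>G s t w. \<exists>c. m = a + c \<and> (\<forall>a'\<in>G s t w. a' + c \<in> G s T r)"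
        using m st tT IT unfolding G_def by (intro run_crossing[of _ _ _ T]) (use adm in auto)
      thus "z \<in> (\<Union>w\<in>I t. R w)" using m GS unfolding R_def by blast
    qed
    moreover have RQ: "R w \<subseteq> Q j" for w using resS by (auto simp: R_def)
    hence finR: "finite (R w)" for w using finQ finite_subset by blast
    ultimately have "card (restr (X j) ` M s) \<le> card (\<Union>w\<in>I t. R w)"
      using finI[OF tT] by (intro card_mono) auto
    also have "\<dots> \<le> (\<Sum>w\<in>I t. card (R w))" using finI[OF tT] by (intro card_UN_le)
    finally have "real (card (restr (X j) ` M s)) \<le> (\<Sum>w\<in>I t. real (card (R w)))"
      by (metis of_nat_le_iff of_nat_sum)
    also have "\<dots> \<le> (\<Sum>w\<in>I t. e * real (num l k))"
    proof (rule sum_mono)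
      fix w assume w: "w \<in> I t"
      show "real (card (R w)) \<le> e * real (num l k)"
      proof (cases "R w = {}")
        case False
        then obtain c1 where c1: "G s t w \<noteq> {}" "\<forall>a\<in>G s t w. a + c1 \<in> S"
          by (auto simp: R_def)
        hence ext: "ext (G s t w)" by (auto simp: ext_def)
        hence "\<not> triv (G s t w)" using Pt w by (auto simp: P_def)
        have "\<exists>a0\<in>G s t w. restr (X j) a0 \<noteq> 0"
        proof (rule ccontr)
          assume "\<not> ?thesis"
          hence "restr (X j) ` G s t w = (\<lambda>_. 0) ` G s t w" by (intro image_cong) auto
          thus False using c1 \<open>\<not> triv (G s t w)\<close> by (simp add: triv_def image_constant_conv)
        qed
        then obtain a0 where a0: "a0 \<in> G s t w" "restr (X j) a0 \<noteq> 0" by blast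
        \<comment> \<open>All contexts of \<open>w\<close> have the same degree in
          \<open>X j\<close>; the two cases are whether it is positive or zero.\<close>
        have dega0: "deg (X j) a0 + deg (X j) c = l ^ k" if "\<forall>a\<in>G s t w. a + c \<in> S" for c
          using that a0 degS[of "a0 + c"] by (simp add: deg_add)
        show ?thesis
        proof (cases "deg (X j) a0 = l ^ k")
          \<comment> \<open>Both \<open>a0\<close> and every context have a nonconstant projection,
            so the projected products stay in one summand of the outermost sum of
            \<open>Q j\<close>.\<close>
          case False
          obtain k' where k': "k = Suc k'" using \<open>k > 0\<close> by (cases k) auto
          have "l * card (R w) \<le> num l (Suc k')"
          proof (rule copyP_split_card[OF copy[OF j, unfolded k'] RQ a0(2)])
            fix m assume "m \<in> R w"
            then obtain a c where ac: "m = restr (X j) (a + c)" "a \<in> G s t w" "\<forall>a'\<in>G s t w. a' + c \<in> S"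
              by (auto simp: R_def)
            have "restr (X j) c \<noteq> 0" using dega0[OF ac(3)] False restr_eq_0_iff[OF finj] by auto
            moreover have "restr (X j) a0 + restr (X j) c \<in> Q j"
              using resS[of "a0 + c"] ac a0 by (simp add: restr_add)
            ultimately show "\<exists>b d. b \<noteq> 0 \<and> restr (X j) a0 + b \<in> Q j \<and> m = d + b"
              using ac by (auto simp: restr_add)
          qed
          hence "real l * real (card (R w)) \<le> real (num l k)"
            unfolding k' by (metis of_nat_le_iff of_nat_mult)
          hence "real (card (R w)) \<le> 1 / real l * real (num l k)"
            using \<open>l > 0\<close> by (simp add: field_simps)
          also have "\<dots> \<le> e * real (num l k)" using assms(4) by (intro mult_right_mono) auto
          finally show ?thesis .
        next
          case True
          \<comment> \<open>Contexts now project to constants, so the projection of \<open>w\<close>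
            itself lies in \<open>Q j\<close> and covers \<open>R w\<close>.\<close>
          have c0: "restr (X j) c = 0" if "\<forall>a\<in>G s t w. a + c \<in> S" for c
            using dega0[OF that] True restr_eq_0_iff[OF finj] by simp
          define F' where "F' = (\<lambda>t u. restr (X j) ` G s t u)"
          \<comment> \<open>Keep \<open>w\<close> at the top and, strictly between \<open>s\<close>
            and \<open>t\<close>, the relevant nodes that do not project to a constant. Each of
            these layers loses a node by minimality of \<open>t\<close>, which reduces the width to
            \<open>n\<close>.\<close>
          define I' where "I' = (\<lambda>t'. if t' = t then {w} else if s < t' \<and> t' < t
            then {u \<in> I t'. ext (G s t' u) \<and> \<not> triv (G s t' u)} else {})"
          have "R w \<subseteq> F' t w"
            using c0 by (auto simp: R_def F'_def restr_add)
          moreover have F'Q: "F' t w \<subseteq> Q j"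
          proof
            fix z assume "z \<in> F' t w"
            then obtain a where "a \<in> G s t w" "z = restr (X j) a" by (auto simp: F'_def)
            thus "z \<in> Q j" using resS[of "a + c1"] c1 c0[of c1] by (simp add: restr_add)
          qed
          ultimately have "card (R w) \<le> card (F' t w)"
            using finQ by (meson card_mono finite_subset)
          moreover have "real (card (F' t w)) \<le> e * real (num l k)"
          proof (rule IH[where Y = "X j" and R = "Q j" and I = I' and F = F' and T = t and r = w])
            show "copyP l k (X j) (Q j)" using copy[OF j] .
            show "F' t w \<subseteq> Q j" using F'Q .
            show "t \<le> 2 ^ l" using T tT by simp
            have "finite (I' t') \<and> card (I' t') \<le> n" if "t' \<le> t" for t'
            proof (cases "t' = t \<or> t' \<le> s")
              case True
              thus ?thesis using \<open>n > 0\<close> st by (auto simp: I'_def)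
            next
              case False
              hence t': "s < t'" "t' < t" using that by auto
              then obtain u where u: "u \<in> I t'" "ext (G s t' u)" "triv (G s t' u)"
                using Pless[of t'] by (auto simp: P_def)
              have "I' t' \<subseteq> I t' - {u}" using t' u by (auto simp: I'_def)
              moreover have "finite (I t' - {u})" "card (I t' - {u}) \<le> n"
                using finI[of t'] t' tT u by auto
              ultimately show ?thesis by (meson card_mono finite_subset le_trans)
            qed
            moreover have "\<exists>g x y. admissible (I' t') x \<and> admissible (I' t') y \<and>
                F' (Suc t') v = gate_val g (operand_val (F' t') x) (operand_val (F' t') y)"
              if t': "t' < t" and v: "v \<in> I' (Suc t')" for t' v
            proof -
              have st': "s \<le> t'" and vI: "v \<in> I (Suc t')" and ev: "ext (G s (Suc t') v)"
                using v t' st w ext by (auto simp: I'_def split: if_splits)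
              define A where "A = operand_val (G s t') (x t' v)"
              define B where "B = operand_val (G s t') (y t' v)"
              have GAB: "G s (Suc t') v = gate_val (g t' v) A B"
                using st' by (simp add: G_def A_def B_def)
              obtain b where b: "\<forall>a\<in>G s (Suc t') v. a + b \<in> S" "G s (Suc t') v \<noteq> {}"
                using ev by (auto simp: ext_def)
              \<comment> \<open>Operands of a relevant gate are empty or relevant: at a product
                gate, an element of the other factor is added to the context.\<close>
              have eA: "A = {} \<or> ext A" and eB: "B = {} \<or> ext B"
              proof -
                consider (plus) "G s (Suc t') v = A \<union> B" | (times) "G s (Suc t') v = A + B"
                  using GAB by (cases "g t' v") auto
                hence "(A = {} \<or> ext A) \<and> (B = {} \<or> ext B)"
                proof cases
                  case plus
                  thus ?thesis using b unfolding ext_def by blast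
                next
                  case times
                  then obtain q where "q \<in> A + B" using b(2) by auto
                  then obtain a1 b1 where ab: "a1 \<in> A" "b1 \<in> B" by (rule set_plus_elim)
                  have "\<forall>a\<in>A. a + (b1 + b) \<in> S" using b(1) ab times by (auto simp: add.assoc[symmetric])
                  moreover have "\<forall>a\<in>B. a + (a1 + b) \<in> S"
                  proof
                    fix a assume "a \<in> B"
                    hence "a1 + a + b \<in> S" using b(1) ab times by auto
                    thus "a + (a1 + b) \<in> S" by (simp add: ac_simps)
                  qed
                  ultimately show ?thesis using ab unfolding ext_def by blast
                qed
                thus "A = {} \<or> ext A" "B = {} \<or> ext B" by auto
              qed
              \<comment> \<open>An operand node with empty or constant projection becomes a leaf;
                any other one is relevant and above layer \<open>s\<close>, hence kept in
                \<open>I'\<close>.\<close>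
              have op: "\<exists>z'. admissible (I' t') z' \<and> operand_val (F' t') z' = restr (X j) ` operand_val (G s t') z"
                if z: "admissible (I t') z" "operand_val (G s t') z = {} \<or> ext (operand_val (G s t') z)" for z
              proof (cases z)
                case (Leaf L)
                thus ?thesis using z leafset_restr[OF finj]
                  by (intro exI[of _ "Leaf (restr (X j) ` L)"]) auto
              next
                case (Node u)
                show ?thesis
                proof (cases "G s t' u = {} \<or> triv (G s t' u)")
                  case True
                  thus ?thesis using Node
                    by (intro exI[of _ "Leaf (restr (X j) ` G s t' u)"]) (auto simp: leafset_def triv_def)
                next
                  case False
                  moreover from this have "s < t'"
                    using run_le[of t' s g x y u] by (auto simp: G_def not_less)
                  ultimately show ?thesis using z Node t'
                    by (intro exI[of _ "Node u"]) (auto simp: I'_def F'_def)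
                qed
              qed
              have adm': "admissible (I t') (x t' v)" "admissible (I t') (y t' v)"
                using adm[OF _ vI] t' tT by auto
              obtain x' where x': "admissible (I' t') x'" "operand_val (F' t') x' = restr (X j) ` A"
                using op[OF adm'(1)] eA unfolding A_def by blast
              obtain y' where y': "admissible (I' t') y'" "operand_val (F' t') y' = restr (X j) ` B"
                using op[OF adm'(2)] eB unfolding B_def by blast
              have "F' (Suc t') v = gate_val (g t' v) (operand_val (F' t') x') (operand_val (F' t') y')"
                unfolding F'_def GAB restr_image_gate_val using x' y' by (simp add: F'_def)
              thus ?thesis using x' y' by blast
            qed
            ultimately show "width_seq n I' F' t w"
              using st unfolding width_seq_def by (auto simp: I'_def)
          qed
          ultimately show ?thesis by linarith
        qed
      qed (use e0 in simp)
    qed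
    also have "\<dots> \<le> real (Suc n) * (e * real (num l k))"
      using finI[OF tT] assms(4)
      by (auto intro!: mult_right_mono mult_nonneg_nonneg intro: order_trans[of 0 "1 / real l" e])
    finally show ?thesis by (simp add: mult.assoc)
  qed
  define K where "K = (real (Suc n) * e * real (num l k)) ^ l"
  have MS: "M s \<subseteq> S" for s using GS by (auto simp: M_def)
  have "card (M s) \<le> K" if "s < T" for s
    unfolding K_def using MS Mj[OF that] by (intro card_le) (auto simp: S_def)
  hence "(\<Sum>s<T. real (card (M s))) \<le> real T * K"
    using sum_bounded_above[of "{..<T}" "\<lambda>s. real (card (M s))" K] by simp
  moreover have "finite S"
  proof -
    have "finite (sum Q J)" if "finite J" "J \<subseteq> {1..l}" for J
      using that copyP_finite[OF copy] by (induction J rule: finite_induct) (auto intro!: finite_set_plus)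
    thus ?thesis by (simp add: S_def)
  qed
  hence "card (F T r) \<le> (\<Sum>s<T. card (M s))"
    using card_mono[OF _ cov] card_UN_le[of "{..<T}" M] MS finite_subset
    by (meson finite_UN finite_lessThan order_trans)
  hence "real (card (F T r)) \<le> (\<Sum>s<T. real (card (M s)))"
    by (metis of_nat_le_iff of_nat_sum)
  moreover have "real T * K \<le> 2 ^ l * K"
  proof (rule mult_right_mono)
    show "real T \<le> 2 ^ l" using T by (metis of_nat_le_iff of_nat_numeral of_nat_power)
    show "K \<ge> 0" using e0 by (simp add: K_def)
  qed
  ultimately show ?thesis unfolding K_def by linarith
qed

text \<open>The fraction \<open>e\<close> is arbitrary because the step for width
  \<open>k + 1\<close> uses the induction hypothesis with a fraction that depends on
  \<open>k\<close>.\<close>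

lemma width_bound:
  fixes e :: real
  assumes "k > 0" "e > 0"
  shows "\<exists>l0>0. \<forall>l>l0. \<forall>X Q I F T r. copyP l k X Q \<longrightarrow> width_seq k I F T r \<longrightarrow> T \<le> 2 ^ l \<longrightarrow>
    F T r \<subseteq> Q \<longrightarrow> real (card (F T r)) \<le> e * real (num l k)"
  using assms
proof (induction k arbitrary: e rule: nat_induct_non_zero)
  case 1
  \<comment> \<open>Beyond 2, no leaf reaches the degree \<open>l\<close>; beyond
    \<open>1 / e\<close>, one of \<open>l\<close> monomials is a fraction at most
    \<open>e\<close>.\<close>
  define l0 where "l0 = max 2 (nat \<lceil>1 / e\<rceil>)"
  have "real (card (F T r)) \<le> e * real (num l 1)"
    if "l > l0" "copyP l 1 X Q" "width_seq 1 I F T r" "F T r \<subseteq> Q" for l X Q I F T r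
  proof -
    have "r \<in> I T" using that by (simp add: width_seq_def)
    moreover have "2 \<le> l" using that by (simp add: l0_def)
    ultimately have "\<forall>m\<in>F T r. \<forall>m'\<in>F T r. m = m'"
      using width_one_unique[OF that(2) _ that(3) order_refl _ that(4)] by blast
    moreover have "finite (F T r)"
      using that copyP_finite finite_subset by blast
    ultimately have "card (F T r) \<le> 1" using card_le_Suc0_iff_eq by (metis One_nat_def)
    moreover have "1 \<le> e * real l"
    proof -
      have "1 / e \<le> real l" using that by (simp add: l0_def) linarith
      thus ?thesis using 1 by (simp add: field_simps)
    qed
    ultimately show ?thesis by (simp add: One_nat_def)
  qed
  thus ?case by (intro exI[of _ l0]) (auto simp: l0_def)
next
  case (Suc k)
  \<comment> \<open>This makes \<open>Suc k * e1 = 1 / 4\<close>, so \<open>width_step\<close>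
    leaves the fraction \<open>2 ^ l * (1 / 4) ^ l = (1 / 2) ^ l\<close>, which is below
    \<open>e\<close> for \<open>l > l2\<close>. The bound \<open>4 * Suc k \<le> l\<close> ensures
    \<open>1 / l \<le> e1\<close>.\<close>
  define e1 where "e1 = 1 / (4 * real (Suc k))"
  have "e1 > 0" by (simp add: e1_def)
  from Suc.IH[OF this] obtain l1 where l1: "\<And>l X Q I F T r. l > l1 \<Longrightarrow> copyP l k X Q \<Longrightarrow>
      width_seq k I F T r \<Longrightarrow> T \<le> 2 ^ l \<Longrightarrow> F T r \<subseteq> Q \<Longrightarrow> real (card (F T r)) \<le> e1 * real (num l k)"
    by blast
  obtain l2 where l2: "(1 / 2 :: real) ^ l2 < e"
    using real_arch_pow_inv[of e "1 / 2"] Suc.prems by auto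
  define l0 where "l0 = Max {1, l1, l2, 4 * Suc k}"
  have "real (card (F T r)) \<le> e * real (num l (Suc k))"
    if l: "l > l0" and Q: "copyP l (Suc k) X Q" and ws: "width_seq (Suc k) I F T r"
      and T: "T \<le> 2 ^ l" and FQ: "F T r \<subseteq> Q" for l X Q I F T r
  proof -
    have l': "l > 0" "l > l1" "l > l2" "l \<ge> 4 * Suc k" using l by (simp_all add: l0_def)
    obtain Y R where YR: "\<And>i. i \<in> {1..l} \<Longrightarrow> block l k (Y i) (R i)"
      "disjoint_family_on (\<lambda>i. \<Union>j\<in>{1..l}. Y i j) {1..l}"
      "X = \<Union>(case_prod Y ` ({1..l} \<times> {1..l}))" "Q = (\<Union>i\<in>{1..l}. \<Sum>j\<in>{1..l}. R i j)"
      using copyP_SucE[OF Q] by metis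
    define Z where "Z = (\<lambda>i. \<Union>j\<in>{1..l}. Y i j)"
    \<comment> \<open>Setting the variables of all other summands to zero isolates the summand
      \<open>i\<close>.\<close>
    define H where "H = (\<lambda>i t v. {m \<in> F t v. keys m \<subseteq> Z i})"
    have sub: "H i T r \<subseteq> (\<Sum>j\<in>{1..l}. R i j)" if i: "i \<in> {1..l}" for i
    proof
      fix m assume m: "m \<in> H i T r"
      then obtain i' where i': "i' \<in> {1..l}" "m \<in> (\<Sum>j\<in>{1..l}. R i' j)"
        using FQ YR(4) by (auto simp: H_def)
      hence kZ: "keys m \<subseteq> Z i'" using block.keys_block[OF YR(1)] by (simp add: Z_def)
      have "deg X m = l ^ Suc k" using copyP_deg[OF Q] m FQ by (auto simp: H_def)
      hence "m \<noteq> 0" using l' by (intro notI) simp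
      moreover have "keys m \<subseteq> Z i" using m by (simp add: H_def)
      ultimately have "Z i \<inter> Z i' \<noteq> {}" using kZ keys_eq_empty[of m] by blast
      hence "i = i'" using YR(2) i i' unfolding Z_def disjoint_family_on_def by blast
      thus "m \<in> (\<Sum>j\<in>{1..l}. R i j)" using i' by simp
    qed
    have Hcard: "real (card (H i T r)) \<le> e * real (num l k) ^ l" if i: "i \<in> {1..l}" for i
    proof -
      have "real (card (H i T r)) \<le> 2 ^ l * (real (Suc k) * e1 * real (num l k)) ^ l"
      proof (rule block.width_step[OF YR(1)[OF i]])
        have "real (4 * Suc k) \<le> real l" using l'(4) by (simp only: of_nat_le_iff)
        thus "1 / real l \<le> e1"
          unfolding e1_def using l'(1) by (intro divide_left_mono) auto
        show "width_seq (Suc k) I (H i) T r"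
          unfolding H_def by (rule width_seq_filter_keys[OF ws])
      qed (use l1[OF l'(2)] l' T sub[OF i] Suc.hyps in auto)
      also have "real (Suc k) * e1 = 1 / 4" by (simp add: e1_def del: of_nat_Suc)
      also have "2 ^ l * (1 / 4 * real (num l k)) ^ l = (1 / 2) ^ l * real (num l k) ^ l"
        by (simp add: power_mult_distrib[symmetric])
      also have "\<dots> \<le> e * real (num l k) ^ l"
      proof (rule mult_right_mono)
        have "(1 / 2 :: real) ^ l \<le> (1 / 2) ^ l2" using l' by (intro power_decreasing) auto
        thus "(1 / 2 :: real) ^ l \<le> e" using l2 by linarith
      qed simp
      finally show ?thesis .
    qed
    have "F T r \<subseteq> (\<Union>i\<in>{1..l}. H i T r)"
    proof
      fix m assume m: "m \<in> F T r"
      then obtain i where i: "i \<in> {1..l}" "m \<in> (\<Sum>j\<in>{1..l}. R i j)"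
        using FQ YR(4) by auto
      hence "keys m \<subseteq> Z i" using block.keys_block[OF YR(1)] by (simp add: Z_def)
      thus "m \<in> (\<Union>i\<in>{1..l}. H i T r)" using m i by (auto simp: H_def)
    qed
    moreover have "finite (F T r)" using FQ copyP_finite[OF Q] finite_subset by blast
    hence "finite (\<Union>i\<in>{1..l}. H i T r)" by (auto simp: H_def)
    ultimately have "card (F T r) \<le> card (\<Union>i\<in>{1..l}. H i T r)"
      by (intro card_mono)
    also have "\<dots> \<le> (\<Sum>i\<in>{1..l}. card (H i T r))"
      by (rule card_UN_le) simp
    finally have "card (F T r) \<le> (\<Sum>i\<in>{1..l}. card (H i T r))" .
    hence "real (card (F T r)) \<le> (\<Sum>i\<in>{1..l}. real (card (H i T r)))"
      by (metis of_nat_le_iff of_nat_sum)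
    also have "\<dots> \<le> (\<Sum>i\<in>{1..l}. e * real (num l k) ^ l)"
      using Hcard by (rule sum_mono)
    finally show ?thesis by (simp add: mult_ac)
  qed
  moreover have "l0 > 0" by (simp add: l0_def)
  ultimately show ?case by (intro exI[of _ l0]) blast
qed

section \<open>Polynomials with nonnegative coefficients\<close>

definition nonneg_poly :: "real mpoly \<Rightarrow> bool" where
  "nonneg_poly p \<longleftrightarrow> (\<forall>m. lookup p m \<ge> 0)"

lemma nonneg_pvar: "nonneg_poly (pvar i)"
  by (simp add: nonneg_poly_def pvar_def lookup_single when_def)

lemma nonneg_pconst: "c \<ge> 0 \<Longrightarrow> nonneg_poly (pconst c)"
  by (simp add: nonneg_poly_def pconst_def lookup_single when_def)

lemma mon_pvar: "mon (pvar i :: real mpoly) = {Poly_Mapping.single i 1}"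
  by (simp add: mon_def pvar_def)

lemma mon_pconst: "mon (pconst c :: real mpoly) = (if c = 0 then {} else {0})"
  by (simp add: mon_def pconst_def)

lemma nonneg_plus:
  assumes "nonneg_poly p" "nonneg_poly q"
  shows "nonneg_poly (p + q)" "mon (p + q) = mon p \<union> mon q"
proof -
  show "nonneg_poly (p + q)" using assms by (simp add: nonneg_poly_def lookup_add)
  have "lookup p m + lookup q m = 0 \<longleftrightarrow> lookup p m = 0 \<and> lookup q m = 0" for m
    using assms by (simp add: nonneg_poly_def add_nonneg_eq_0_iff)
  thus "mon (p + q) = mon p \<union> mon q"
    by (simp add: set_eq_iff mon_def in_keys_iff lookup_add)
qed

lemma poly_mapping_sum_single: "p = (\<Sum>a\<in>keys p. Poly_Mapping.single a (lookup p a))"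
  by (rule poly_mapping_eqI) (auto simp: lookup_sum lookup_single when_def in_keys_iff)

lemma lookup_times_sum:
  fixes p q :: "real mpoly"
  shows "lookup (p * q) m =
    (\<Sum>a\<in>keys p. \<Sum>b\<in>keys q. if a + b = m then lookup p a * lookup q b else 0)"
proof -
  have "p * q = (\<Sum>a\<in>keys p. Poly_Mapping.single a (lookup p a)) *
      (\<Sum>b\<in>keys q. Poly_Mapping.single b (lookup q b))"
    by (rule arg_cong2[of p _ q _ "(*)", OF poly_mapping_sum_single poly_mapping_sum_single])
  also have "\<dots> = (\<Sum>a\<in>keys p. \<Sum>b\<in>keys q. Poly_Mapping.single (a + b) (lookup p a * lookup q b))"
    by (simp add: sum_product mult_single)
  finally show ?thesis by (simp add: lookup_sum lookup_single when_def)
qed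

text \<open>The coefficient of \<open>a + b\<close> is a sum of nonnegative terms, among them the
  positive term of the pair \<open>a\<close>, \<open>b\<close>, so nothing cancels.\<close>

lemma nonneg_times:
  assumes "nonneg_poly p" "nonneg_poly q"
  shows "nonneg_poly (p * q)" "mon (p * q) = mon p + mon q"
proof -
  note nn = assms[unfolded nonneg_poly_def, rule_format]
  show "nonneg_poly (p * q)"
    unfolding nonneg_poly_def lookup_times_sum using nn by (auto intro!: sum_nonneg)
  show "mon (p * q) = mon p + mon q"
  proof
    show "mon (p * q) \<subseteq> mon p + mon q"
      using keys_mult[of p q] by (auto simp: mon_def)
    show "mon p + mon q \<subseteq> mon (p * q)"
    proof
      fix m assume "m \<in> mon p + mon q"
      then obtain a b where ab: "m = a + b" "a \<in> keys p" "b \<in> keys q"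
        by (auto simp: mon_def elim: set_plus_elim)
      have "0 < lookup p a * lookup q b"
        using ab nn[of a] nn(2)[of b] by (auto simp: in_keys_iff less_le)
      also have "\<dots> = (if a + b = m then lookup p a * lookup q b else 0)" using ab by simp
      also have "\<dots> \<le> (\<Sum>b\<in>keys q. if a + b = m then lookup p a * lookup q b else 0)"
        using ab nn by (intro member_le_sum) auto
      also have "\<dots> \<le> (\<Sum>a\<in>keys p. \<Sum>b\<in>keys q. if a + b = m then lookup p a * lookup q b else 0)"
        by (rule member_le_sum) (use ab nn in \<open>auto intro!: sum_nonneg\<close>)
      finally have "lookup (p * q) m > 0" by (simp add: lookup_times_sum)
      thus "m \<in> mon (p * q)" by (simp add: mon_def in_keys_iff)
    qed
  qed
qed

lemma nonneg_sum:
  assumes "\<And>i. i \<in> I \<Longrightarrow> nonneg_poly (p i)" "finite I"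
  shows "nonneg_poly (sum p I) \<and> mon (sum p I) = (\<Union>i\<in>I. mon (p i))"
  using assms(2,1)
proof (induction I rule: finite_induct)
  case empty
  thus ?case by (simp add: nonneg_poly_def mon_def)
next
  case (insert i I)
  thus ?case by (simp add: nonneg_plus)
qed

lemma nonneg_prod:
  assumes "\<And>i. i \<in> I \<Longrightarrow> nonneg_poly (p i)" "finite I"
  shows "nonneg_poly (prod p I) \<and> mon (prod p I) = (\<Sum>i\<in>I. mon (p i))"
  using assms(2,1)
proof (induction I rule: finite_induct)
  case empty
  thus ?case by (simp add: nonneg_poly_def mon_def lookup_one when_def)
next
  case (insert i I)
  thus ?case by (simp add: nonneg_times)
qed

section \<open>Numbering the variables of \<open>P\<close>\<close>

definition offset :: "nat \<Rightarrow> nat \<Rightarrow> nat \<Rightarrow> nat \<Rightarrow> nat" where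
  "offset l d i j = (i - 1) * (l * d) + (j - 1) * d"

text \<open>Counted from 0, a position is a mixed radix number with digits \<open>a\<close> and
  \<open>b\<close> below \<open>l\<close> and \<open>r\<close> below \<open>d\<close>.\<close>

lemma offset_Suc: "offset l d (Suc a) (Suc b) + Suc r = Suc ((a * l + b) * d + r)"
  by (simp add: offset_def algebra_simps)

lemma offset_inj:
  assumes "a < l" "b < l" "r < d" "a' < l" "b' < l" "r' < d"
    "(a * l + b) * d + r = (a' * l + b') * d + (r' :: nat)"
  shows "a = a' \<and> b = b' \<and> r = r'"
proof -
  have "((a * l + b) * d + r) div d = a * l + b" "((a * l + b) * d + r) mod d = r"
    "((a' * l + b') * d + r') div d = a' * l + b'" "((a' * l + b') * d + r') mod d = r'"
    using assms(1-6) by simp_all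
  hence eq: "a * l + b = a' * l + b'" "r = r'" using assms(7) by metis+
  have "(a * l + b) div l = a" "(a * l + b) mod l = b"
    "(a' * l + b') div l = a'" "(a' * l + b') mod l = b'"
    using assms(1-6) by simp_all
  hence "a = a'" "b = b'" using eq(1) by metis+
  thus ?thesis using eq by simp
qed

lemma offset_less:
  assumes "a < l" "b < l" "r < d"
  shows "(a * l + b) * d + r < l * l * (d :: nat)"
proof -
  have le: "x * n + z < m * n" if "x < m" "z < n" for x z m n :: nat
  proof -
    have "x * n + z < Suc x * n" using that by simp
    also have "\<dots> \<le> m * n" using that by (intro mult_le_mono1) simp
    finally show ?thesis .
  qed
  show ?thesis using assms by (intro le)
qed

text \<open>Division with remainder by \<open>d\<close> and then by \<open>l\<close> finds the
  interval that contains a given index.\<close>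

lemma offset_image:
  "(\<Union>i\<in>{1..l}. \<Union>j\<in>{1..l}. (\<lambda>m. offset l d i j + m) ` {1..d}) = {1..l * l * d}"
proof (intro equalityI subsetI)
  fix n assume "n \<in> (\<Union>i\<in>{1..l}. \<Union>j\<in>{1..l}. (\<lambda>m. offset l d i j + m) ` {1..d})"
  then obtain i j m where ijm: "i \<in> {1..l}" "j \<in> {1..l}" "m \<in> {1..d}" "n = offset l d i j + m"
    by blast
  then obtain a b r where abr: "i = Suc a" "j = Suc b" "m = Suc r"
    by (metis atLeastAtMost_iff not_one_le_zero not0_implies_Suc)
  have "n = Suc ((a * l + b) * d + r)" using ijm(4) unfolding abr offset_Suc .
  thus "n \<in> {1..l * l * d}" using ijm(1-3) offset_less[of a l b r d] by (auto simp: abr)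
next
  fix n assume n: "n \<in> {1..l * l * d}"
  then obtain n' where n': "n = Suc n'" "n' < l * l * d" by (cases n) auto
  hence d: "d > 0" "l > 0" by (auto intro: gr0I)
  define q where "q = n' div d"
  have q: "q < l * l" using n' d by (simp add: q_def less_mult_imp_div_less)
  have "n' = ((q div l) * l + q mod l) * d + n' mod d" by (simp add: q_def)
  hence "n = offset l d (Suc (q div l)) (Suc (q mod l)) + Suc (n' mod d)"
    unfolding offset_Suc n'(1) by simp
  moreover have "Suc (q div l) \<in> {1..l}" "Suc (q mod l) \<in> {1..l}" "Suc (n' mod d) \<in> {1..d}"
    using q d by (auto simp: less_mult_imp_div_less Suc_le_eq)
  ultimately show "n \<in> (\<Union>i\<in>{1..l}. \<Union>j\<in>{1..l}. (\<lambda>m. offset l d i j + m) ` {1..d})" by blast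
qed

text \<open>Serves both levels of the recursion: \<open>d = 1\<close> with variables as factors, and
  \<open>d = l ^ (2 * k)\<close> with copies of level \<open>k\<close>.\<close>

lemma copyP_sum_prod:
  assumes "inj_on y {1..l * l * d}"
    and p: "\<And>i j. i \<in> {1..l} \<Longrightarrow> j \<in> {1..l} \<Longrightarrow>
      nonneg_poly (p i j) \<and> copyP l k (y ` (\<lambda>m. offset l d i j + m) ` {1..d}) (mon (p i j))"
  shows "nonneg_poly (\<Sum>i=1..l. \<Prod>j=1..l. p i j) \<and>
    copyP l (Suc k) (y ` {1..l * l * d}) (mon (\<Sum>i=1..l. \<Prod>j=1..l. p i j))"
proof -
  define Y where "Y = (\<lambda>i j. y ` (\<lambda>m. offset l d i j + m) ` {1..d})"
  have prod: "nonneg_poly (\<Prod>j=1..l. p i j) \<and> mon (\<Prod>j=1..l. p i j) = (\<Sum>j=1..l. mon (p i j))"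
    if "i \<in> {1..l}" for i
    using that p by (intro nonneg_prod) auto
  hence sum: "nonneg_poly (\<Sum>i=1..l. \<Prod>j=1..l. p i j) \<and>
      mon (\<Sum>i=1..l. \<Prod>j=1..l. p i j) = (\<Union>i\<in>{1..l}. mon (\<Prod>j=1..l. p i j))"
    by (intro nonneg_sum) auto
  have "copyP l (Suc k) (\<Union>(case_prod Y ` ({1..l} \<times> {1..l}))) (\<Union>i\<in>{1..l}. \<Sum>j\<in>{1..l}. mon (p i j))"
  proof (rule copyP.Suc)
    show "copyP l k (Y i j) (mon (p i j))" if "i \<in> {1..l}" "j \<in> {1..l}" for i j
      using p that by (simp add: Y_def)
    show "disjoint_family_on (case_prod Y) ({1..l} \<times> {1..l})"
      unfolding disjoint_family_on_def
    proof (intro ballI impI, rule ccontr)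
      fix u v assume uv: "u \<in> {1..l} \<times> {1..l}" "v \<in> {1..l} \<times> {1..l}" "u \<noteq> v"
        "case_prod Y u \<inter> case_prod Y v \<noteq> {}"
      obtain i j i' j' where ij: "u = (i, j)" "v = (i', j')" by (cases u, cases v)
      obtain m m' where m: "m \<in> {1..d}" "m' \<in> {1..d}"
          "y (offset l d i j + m) = y (offset l d i' j' + m')"
        using uv(4) unfolding ij Y_def prod.case by blast
      have "offset l d i j + m \<in> {1..l * l * d}" "offset l d i' j' + m' \<in> {1..l * l * d}"
        unfolding offset_image[symmetric] using uv m ij by blast+
      hence eq: "offset l d i j + m = offset l d i' j' + m'"
        using assms(1) m(3) by (meson inj_onD)
      have pre: "\<exists>a. x = Suc a" if "x \<in> {1..n}" for x n
        using that by (cases x) auto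
      obtain a b r a' b' r' where abr: "i = Suc a" "j = Suc b" "m = Suc r" "i' = Suc a'" "j' = Suc b'" "m' = Suc r'"
        using uv(1,2) m(1,2) pre unfolding ij by (metis SigmaD1 SigmaD2)
      have "a = a' \<and> b = b' \<and> r = r'"
        using offset_inj[of a l b r d a' b' r'] eq uv m unfolding ij abr offset_Suc by auto
      thus False using uv(3) ij abr by simp
    qed
  qed
  moreover have "\<Union>(case_prod Y ` ({1..l} \<times> {1..l})) = y ` {1..l * l * d}"
    unfolding offset_image[symmetric] Y_def by blast
  moreover have "mon (\<Sum>i=1..l. \<Prod>j=1..l. p i j) = (\<Union>i\<in>{1..l}. \<Sum>j\<in>{1..l}. mon (p i j))"
    using sum prod by simp
  ultimately show ?thesis using sum by simp
qed

text \<open>The renaming \<open>y\<close> is general so that the induction hypothesis covers the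
  shifted arguments of the factors.\<close>

lemma copyP_Pform:
  assumes "k > 0" "inj_on y {1..l ^ (2 * k)}"
  shows "nonneg_poly (Pform l k (\<lambda>m. pvar (y m))) \<and>
    copyP l k (y ` {1..l ^ (2 * k)}) (mon (Pform l k (\<lambda>m. pvar (y m)) :: real mpoly))"
  using assms
proof (induction k arbitrary: y rule: nat_induct_non_zero)
  case 1
  have "nonneg_poly (\<Sum>i=1..l. \<Prod>j=1..l. pvar (y ((i - 1) * l + j))) \<and>
      copyP l (Suc 0) (y ` {1..l * l * 1}) (mon (\<Sum>i=1..l. \<Prod>j=1..l. pvar (y ((i - 1) * l + j)) :: real mpoly))"
  proof (rule copyP_sum_prod)
    show "inj_on y {1..l * l * 1}" using 1 by (simp add: power2_eq_square)
    fix i j assume "i \<in> {1..l}" "j \<in> {1..l}"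
    hence "(i - 1) * l + j = offset l 1 i j + 1" by (simp add: offset_def)
    thus "nonneg_poly (pvar (y ((i - 1) * l + j))) \<and>
        copyP l 0 (y ` (\<lambda>m. offset l 1 i j + m) ` {1..1}) (mon (pvar (y ((i - 1) * l + j)) :: real mpoly))"
      using copyP.zero by (simp add: nonneg_pvar mon_pvar)
  qed
  thus ?case by (simp add: One_nat_def power2_eq_square)
next
  case (Suc k)
  obtain k' where k': "k = Suc k'" using Suc.hyps by (cases k) auto
  define d where "d = l ^ (2 * k)"
  have d: "l ^ (2 * Suc k) = l * l * d" by (simp add: d_def)
  let ?p = "\<lambda>i j. Pform l k (\<lambda>m. pvar (y (offset l d i j + m))) :: real mpoly"
  have "nonneg_poly (\<Sum>i=1..l. \<Prod>j=1..l. ?p i j) \<and>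
      copyP l (Suc k) (y ` {1..l * l * d}) (mon (\<Sum>i=1..l. \<Prod>j=1..l. ?p i j))"
  proof (rule copyP_sum_prod)
    show inj: "inj_on y {1..l * l * d}" using Suc.prems unfolding d .
    fix i j assume ij: "i \<in> {1..l}" "j \<in> {1..l}"
    have "(\<lambda>m. offset l d i j + m) ` {1..d} \<subseteq> {1..l * l * d}"
      unfolding offset_image[symmetric] using ij by blast
    hence "inj_on y ((\<lambda>m. offset l d i j + m) ` {1..d})" using inj by (rule inj_on_subset[rotated])
    hence "inj_on (y \<circ> (\<lambda>m. offset l d i j + m)) {1..d}"
      by (intro comp_inj_on) (simp_all only: inj_on_add)
    hence "inj_on (\<lambda>m. y (offset l d i j + m)) {1..l ^ (2 * k)}"
      by (simp only: d_def[symmetric] o_def)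
    from Suc.IH[OF this]
    show "nonneg_poly (?p i j) \<and> copyP l k (y ` (\<lambda>m. offset l d i j + m) ` {1..d}) (mon (?p i j))"
      by (simp only: d_def[symmetric] image_image)
  qed
  moreover have "Pform l (Suc k) (\<lambda>m. pvar (y m) :: real mpoly) = (\<Sum>i=1..l. \<Prod>j=1..l. ?p i j)"
    by (simp add: k' offset_def d_def add.assoc)
  ultimately show ?case by (simp only: d)
qed

lemma copyP_P:
  assumes "k > 0"
  shows "copyP l k {1..l ^ (2 * k)} (mon (P l k))"
  using copyP_Pform[OF assms, of "\<lambda>m. m" l] by (simp add: P_def)

section \<open>Circuits\<close>

lemma nonneg_computes:
  assumes "arithmetic_circuit C" "monotone_circuit C"
  shows "computes C v p \<Longrightarrow> v \<in> nodes C \<Longrightarrow> nonneg_poly p"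
proof (induction rule: computes.induct)
  case (1 v i)
  thus ?case by (simp add: nonneg_pvar)
next
  case (2 v c)
  thus ?case using assms(2) by (auto simp: monotone_circuit_def intro: nonneg_pconst)
next
  case (3 v u w p q)
  hence "children C v = {u, w}" by (simp add: children_def)
  hence "{u, w} \<subseteq> nodes C" using 3 assms(1) unfolding arithmetic_circuit_def by metis
  thus ?case using 3 nonneg_plus by simp
next
  case (4 v u w p q)
  hence "children C v = {u, w}" by (simp add: children_def)
  hence "{u, w} \<subseteq> nodes C" using 4 assms(1) unfolding arithmetic_circuit_def by metis
  thus ?case using 4 nonneg_times by simp
qed

lemma layering_subset: "layering C Vs \<Longrightarrow> i < length Vs \<Longrightarrow> Vs ! i \<subseteq> nodes C"
  using nth_mem[of i Vs] by (auto simp: layering_def)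

lemma layering_disjoint:
  "layering C Vs \<Longrightarrow> i < length Vs \<Longrightarrow> j < length Vs \<Longrightarrow> i \<noteq> j \<Longrightarrow> Vs ! i \<inter> Vs ! j = {}"
  by (simp add: layering_def)

text \<open>Layers are nonempty and disjoint, so choosing a node from each is injective.\<close>

lemma length_layers_le:
  assumes "arithmetic_circuit C" "layering C Vs"
  shows "length Vs \<le> circuit_size C"
proof -
  define f where "f = (\<lambda>i. SOME v. v \<in> Vs ! i)"
  have f: "f i \<in> Vs ! i" if "i < length Vs" for i
    using that assms(2) unfolding f_def some_in_eq by (simp add: layering_def)
  have "inj_on f {..<length Vs}"
  proof (rule inj_onI, rule ccontr)
    fix i j assume ij: "i \<in> {..<length Vs}" "j \<in> {..<length Vs}" "f i = f j" "i \<noteq> j"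
    hence "f i \<in> Vs ! i" "f i \<in> Vs ! j" using f[of i] f[of j] by simp_all
    moreover have "Vs ! i \<inter> Vs ! j = {}" using layering_disjoint[OF assms(2)] ij by simp
    ultimately show False by blast
  qed
  moreover have "f ` {..<length Vs} \<subseteq> nodes C" using f layering_subset[OF assms(2)] by auto
  moreover have "finite (nodes C)" using assms(1) by (simp add: arithmetic_circuit_def)
  ultimately have "card {..<length Vs} \<le> card (nodes C)" by (rule card_inj_on_le)
  thus ?thesis by (simp add: circuit_size_def)
qed

text \<open>The sequence stops at the layer of the output, which is cut down to the output node;
  later layers are dropped.\<close>

lemma circuit_width_seq:
  assumes C: "arithmetic_circuit C" and mono: "monotone_circuit C" and lay: "layering C Vs"
    and "width Vs \<le> k" "k > 0"
  obtains I F T r where "width_seq k I F T r" "T \<le> circuit_size C"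
    "F T r = mon (circuit_poly C)"
proof -
  define val where "val = (\<lambda>v. SOME p. computes C v p)"
  define out where "out = output_node C"
  have fin: "finite (nodes C)" and out: "out \<in> nodes C"
    and ch: "\<And>v. v \<in> nodes C \<Longrightarrow> children C v \<subseteq> nodes C"
    using C by (auto simp: arithmetic_circuit_def out_def)
  have val: "computes C v (val v)" if "v \<in> nodes C" for v
    using computes_exists[OF C that] unfolding val_def by (rule someI_ex)
  have nonneg: "nonneg_poly (val v)" if "v \<in> nodes C" for v
    using nonneg_computes[OF C mono val[OF that] that] .
  have val_out: "val out = circuit_poly C"
    using computes_unique[OF val[OF out]] computes_circuit_poly[OF C] by (simp add: out_def)
  define F where "F = (\<lambda>(t :: nat) v. mon (val v))"
  have leaf: "leafset (mon (val v))" if v: "v \<in> Vs ! 0" for v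
  proof -
    have v': "v \<in> nodes C" "children C v = {}"
      using v lay by (auto simp: layering_def leaves_def)
    from val[OF v'(1)] show ?thesis
    proof cases
      case (1 i)
      thus ?thesis by (auto simp: mon_pvar leafset_def)
    next
      case (2 c)
      thus ?thesis by (auto simp: mon_pconst leafset_def)
    qed (use v' in \<open>auto simp: children_def\<close>)
  qed
  obtain i where i: "i < length Vs" "out \<in> Vs ! i"
    
  proof -
    have "out \<in> \<Union>(set Vs)" using out lay by (simp add: layering_def)
    thus thesis using that by (auto simp: in_set_conv_nth)
  qed
  show thesis
  proof (cases "i = 0")
    case True
    \<comment> \<open>A leaf output lies in no counted layer. An artificial layer holds a sum gate
      that joins the leaf with itself.\<close>
    define I where "I = (\<lambda>t :: nat. if t = 1 then {out} else {})"
    have "width_seq k I F 1 out"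
      unfolding width_seq_def
    proof (intro conjI allI impI ballI)
      fix t v assume "t < (1 :: nat)" "v \<in> I (Suc t)"
      hence "v = out" by (auto simp: I_def split: if_splits)
      moreover have "admissible (I t) (Leaf (F t out))" using leaf i True by (simp add: F_def)
      moreover have "F (Suc t) out = gate_val True (operand_val (F t) (Leaf (F t out)))
          (operand_val (F t) (Leaf (F t out)))" by (simp add: F_def)
      ultimately show "\<exists>g x y. admissible (I t) x \<and> admissible (I t) y \<and>
          F (Suc t) v = gate_val g (operand_val (F t) x) (operand_val (F t) y)" by blast
    qed (use \<open>k > 0\<close> in \<open>auto simp: I_def\<close>)
    moreover have "1 \<le> circuit_size C"
      using length_layers_le[OF C lay] i by linarith
    ultimately show thesis using that val_out by (metis F_def)
  next
    case False
    define I where "I = (\<lambda>t. if t = i then {out} else if 0 < t \<and> t < i then Vs ! t else {})"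
    have I_sub: "I t \<subseteq> Vs ! t" for t using i by (simp add: I_def)
    have "width_seq k I F i out"
      unfolding width_seq_def
    proof (intro conjI allI impI ballI)
      fix t assume "t \<le> i"
      hence t: "t < length Vs" using i by simp
      show "finite (I t)" using finite_subset[OF I_sub finite_subset[OF layering_subset[OF lay t] fin]] .
      show "card (I t) \<le> k"
      proof (cases "0 < t \<and> t < i")
        case True
        hence "Vs ! t = tl Vs ! (t - 1)" "t - 1 < length (tl Vs)"
          using t nth_tl[of "t - 1" Vs] by auto
        hence "card (Vs ! t) \<le> width Vs"
          unfolding width_def by (intro Max_ge) auto
        thus ?thesis using True \<open>width Vs \<le> k\<close> by (simp add: I_def)
      qed (use \<open>k > 0\<close> in \<open>auto simp: I_def\<close>)
    next
      fix t v assume t: "t < i" and v: "v \<in> I (Suc t)"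
      have vV: "v \<in> Vs ! Suc t" using v I_sub by blast
      have St: "Suc t < length Vs" using t i by simp
      have vn: "v \<in> nodes C" using vV layering_subset[OF lay St] by blast
      have chV: "children C v \<subseteq> Vs ! 0 \<union> Vs ! t"
      proof -
        have "\<forall>i<length Vs. 0 < i \<longrightarrow> (\<forall>v\<in>Vs ! i. children C v \<subseteq> Vs ! 0 \<union> Vs ! (i - 1))"
          using lay unfolding layering_def by (elim conjE)
        from this[rule_format, OF St _ vV] show ?thesis by simp
      qed
      have "Vs ! Suc t \<inter> Vs ! 0 = {}"
        using St by (intro layering_disjoint[OF lay]) auto
      hence nonleaf: "children C v \<noteq> {}"
        using vV vn lay by (auto simp: layering_def leaves_def)
      have op: "\<exists>x. admissible (I t) x \<and> operand_val (F t) x = mon (val u)" if "u \<in> children C v" for u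
      proof (cases "u \<in> Vs ! 0")
        case True
        thus ?thesis using leaf by (intro exI[of _ "Leaf (mon (val u))"]) simp
      next
        case False
        hence "u \<in> Vs ! t" using that chV by auto
        hence "t \<noteq> 0" using False by (intro notI) simp
        hence "u \<in> I t" using t \<open>u \<in> Vs ! t\<close> by (simp add: I_def)
        thus ?thesis by (intro exI[of _ "Node u"]) (simp add: F_def)
      qed
      have "\<exists>g u w. u \<in> children C v \<and> w \<in> children C v \<and>
          mon (val v) = gate_val g (mon (val u)) (mon (val w))"
        using val[OF vn]
      proof cases
        case (3 u w p q)
        hence uw: "children C v = {u, w}" by (simp add: children_def)
        hence n: "u \<in> nodes C" "w \<in> nodes C" using ch[OF vn] by auto
        hence "p = val u" "q = val w" using 3 val computes_unique by blast+
        hence "mon (val v) = gate_val True (mon (val u)) (mon (val w))"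
          using 3 nonneg_plus nonneg n by simp
        thus ?thesis using uw by blast
      next
        case (4 u w p q)
        hence uw: "children C v = {u, w}" by (simp add: children_def)
        hence n: "u \<in> nodes C" "w \<in> nodes C" using ch[OF vn] by auto
        hence "p = val u" "q = val w" using 4 val computes_unique by blast+
        hence "mon (val v) = gate_val False (mon (val u)) (mon (val w))"
          using 4 nonneg_times nonneg n by simp
        thus ?thesis using uw by blast
      qed (use nonleaf in \<open>auto simp: children_def\<close>)
      then obtain g u w where guw: "u \<in> children C v" "w \<in> children C v"
          "F (Suc t) v = gate_val g (mon (val u)) (mon (val w))"
        by (auto simp: F_def)
      thus "\<exists>g x y. admissible (I t) x \<and> admissible (I t) y \<and>
          F (Suc t) v = gate_val g (operand_val (F t) x) (operand_val (F t) y)"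
        using op[OF guw(1)] op[OF guw(2)] by metis
    qed (use False in \<open>auto simp: I_def\<close>)
    moreover have "i \<le> circuit_size C" using length_layers_le[OF C lay] i by linarith
    ultimately show thesis using that val_out by (metis F_def)
  qed
qed

theorem theorem1:
  fixes k :: nat
  assumes "k > 0"
  shows "\<exists>l0>0. \<forall>l>l0. \<forall>(C :: real circuit) Vs.
           arithmetic_circuit C \<longrightarrow> monotone_circuit C \<longrightarrow>
           layering C Vs \<longrightarrow> width Vs = k \<longrightarrow>
           mon (circuit_poly C) \<subseteq> mon (P l k) \<longrightarrow>
           real (card (mon (circuit_poly C))) \<ge> real (card (mon (P l k))) / 2 \<longrightarrow>
           real (circuit_size C) \<ge> 2 ^ l / 10"
proof -
  \<comment> \<open>Any fraction below one half contradicts the assumed number of monomials.\<close>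
  obtain l0 where l0: "l0 > 0" "\<And>l X Q I F T r. l > l0 \<Longrightarrow> copyP l k X Q \<Longrightarrow> width_seq k I F T r \<Longrightarrow>
      T \<le> 2 ^ l \<Longrightarrow> F T r \<subseteq> Q \<Longrightarrow> real (card (F T r)) \<le> 1 / 4 * real (num l k)"
    using width_bound[OF assms, of "1 / 4"] by auto
  have "2 ^ l / 10 \<le> real (circuit_size C)"
    if l: "l > l0" and C: "arithmetic_circuit C" "monotone_circuit C" "layering C Vs" "width Vs = k"
      and sub: "mon (circuit_poly C) \<subseteq> mon (P l k)"
      and half: "real (card (mon (P l k))) / 2 \<le> real (card (mon (circuit_poly C)))"
    for l C Vs
  proof (rule ccontr)
    assume size: "\<not> ?thesis"
    obtain I F T r where seq: "width_seq k I F T r" "T \<le> circuit_size C" "F T r = mon (circuit_poly C)"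
      using circuit_width_seq[OF C(1-3)] C(4) assms by (metis order_refl)
    \<comment> \<open>A size below \<open>2 ^ l / 10\<close> keeps the number of layers within the
      \<open>2 ^ l\<close> that \<open>width_bound\<close> allows.\<close>
    have "real T \<le> real (circuit_size C)" using seq(2) by (rule of_nat_mono)
    moreover have "(0 :: real) < 2 ^ l" by simp
    ultimately have "real T \<le> 2 ^ l" using size by linarith
    hence "T \<le> 2 ^ l" by (metis of_nat_le_iff of_nat_numeral of_nat_power)
    note copy = copyP_P[OF assms, of l]
    have "real (card (F T r)) \<le> 1 / 4 * real (num l k)"
      using l0(2)[OF l copy seq(1) \<open>T \<le> 2 ^ l\<close>] seq(3) sub by simp
    moreover have "num l k > 0" using num_pos l by simp
    ultimately show False using half seq(3) copyP_card[OF copy] by simp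
  qed
  thus ?thesis using l0(1) by blast
qed

end
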